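(* Let $G$ be a finite Abelian group of order $n$. Then $\chi(G) = n$ if the Sylow 2-subgroups of $G$ are either trivial or non-cyclic, and $\chi(G) = n+2$ otherwise (i.e. if the Sylow 2-subgroups of $G$ are nontrivial and cyclic).
   Context: A latin square of order $n$ is an $n\times n$ array in which each row and each column is a permutation of a set of $n$ symbols. A partial transversal of a latin square is a set of cells containing at most one cell from each row, at most one cell from each column, and at most one cell containing each symbol. A $k$-coloring of a latin square $L$ is a partition of its cells into $k$ partial transversals, and the chromatic number $\chi(L)$ is the least $k$ for which a $k$-coloring exists (equivalently, the chromatic number of the graph on the cells of $L$ in which two distinct cells are adjacent iff they share a row, share a column, or contain the same symbol). For a finite group $G=\{g_0,\dots,g_{n-1}\}$, its Cayley table $L(G)$ is the latin square whose $(i,j)$ entry is $g_ig_j$; $\chi(G)$ denotes $\chi(L(G))$ (this does not depend on the ordering of $G$). *)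

theory Defs
  imports "HOL-Algebra.Algebra" "HOL-Library.Disjoint_Sets"
begin

(* An n x n array is a function on pairs of indices, of which only the values at
   indices below n matter. *)

definition latin_square :: "nat \<Rightarrow> (nat \<Rightarrow> nat \<Rightarrow> 'a) \<Rightarrow> bool" where
  "latin_square n L \<longleftrightarrow>
     (\<exists>S. card S = n \<and> finite S \<and>
       (\<forall>i<n. bij_betw (\<lambda>j. L i j) {..<n} S) \<and>
       (\<forall>j<n. bij_betw (\<lambda>i. L i j) {..<n} S))"

definition cells :: "nat \<Rightarrow> (nat \<times> nat) set" where
  "cells n = {..<n} \<times> {..<n}"

definition partial_transversal ::
    "nat \<Rightarrow> (nat \<Rightarrow> nat \<Rightarrow> 'a) \<Rightarrow> (nat \<times> nat) set \<Rightarrow> bool" where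
  "partial_transversal n L T \<longleftrightarrow>
     T \<subseteq> cells n \<and> inj_on fst T \<and> inj_on snd T \<and> inj_on (\<lambda>(i, j). L i j) T"

definition latin_coloring ::
    "nat \<Rightarrow> (nat \<Rightarrow> nat \<Rightarrow> 'a) \<Rightarrow> nat \<Rightarrow> (nat \<times> nat) set set \<Rightarrow> bool" where
  "latin_coloring n L k \<C> \<longleftrightarrow>
     partition_on (cells n) \<C> \<and> card \<C> = k \<and> (\<forall>T\<in>\<C>. partial_transversal n L T)"

definition latin_chromatic_number :: "nat \<Rightarrow> (nat \<Rightarrow> nat \<Rightarrow> 'a) \<Rightarrow> nat" where
  "latin_chromatic_number n L = (LEAST k. \<exists>\<C>. latin_coloring n L k \<C>)"

(* The function g enumerates the elements of the group as g 0, ..., g (n - 1). *)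

definition cayley_table ::
    "('a, 'b) monoid_scheme \<Rightarrow> (nat \<Rightarrow> 'a) \<Rightarrow> nat \<Rightarrow> nat \<Rightarrow> 'a" where
  "cayley_table G g i j = g i \<otimes>\<^bsub>G\<^esub> g j"

definition sylow_subgroup :: "nat \<Rightarrow> ('a, 'b) monoid_scheme \<Rightarrow> 'a set \<Rightarrow> bool" where
  "sylow_subgroup p G P \<longleftrightarrow> subgroup P G \<and> card P = p ^ multiplicity p (order G)"

(* The minimum in latin_chromatic_number is attained: single cells form a coloring. *)

lemma latin_coloring_exists: "\<exists>k \<C>. latin_coloring n L k \<C>"
proof -
  have "partition_on (cells n) ((\<lambda>c. {c}) ` cells n)"
    by (auto simp: partition_on_def disjoint_def)
  moreover have "\<forall>T\<in>(\<lambda>c. {c}) ` cells n. partial_transversal n L T"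
    by (auto simp: partial_transversal_def)
  ultimately show ?thesis
    unfolding latin_coloring_def by blast
qed

lemma (in group) latin_square_cayley_table:
  assumes fin: "finite (carrier G)" and g: "bij_betw g {..<order G} (carrier G)"
  shows "latin_square (order G) (cayley_table G g)"
proof -
  have mem: "g i \<in> carrier G" if "i < order G" for i
    using g that by (auto simp: bij_betw_def)
  have l: "bij_betw (\<lambda>y. x \<otimes> y) (carrier G) (carrier G)" if "x \<in> carrier G" for x
    using that by (intro bij_betwI[where g = "\<lambda>y. inv x \<otimes> y"]) (auto simp: m_assoc[symmetric])
  have r: "bij_betw (\<lambda>y. y \<otimes> x) (carrier G) (carrier G)" if "x \<in> carrier G" for x
    using that by (intro bij_betwI[where g = "\<lambda>y. y \<otimes> inv x"]) (auto simp: m_assoc)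
  have "bij_betw (\<lambda>j. cayley_table G g i j) {..<order G} (carrier G)"
    if "i < order G" for i
    using bij_betw_trans[OF g l[OF mem[OF that]]] by (simp add: cayley_table_def comp_def)
  moreover have "bij_betw (\<lambda>i. cayley_table G g i j) {..<order G} (carrier G)"
    if "j < order G" for j
    using bij_betw_trans[OF g r[OF mem[OF that]]] by (simp add: cayley_table_def comp_def)
  ultimately show ?thesis
    unfolding latin_square_def using fin by (auto simp: order_def)
qed

lemma (in group) sylow_subgroup_exists:
  assumes "finite (carrier G)" "Factorial_Ring.prime p"
  shows "\<exists>P. sylow_subgroup p G P"
proof -
  have "order G \<noteq> 0"
    using assms(1) order_gt_0_iff_finite by simp
  then obtain m where "order G = p ^ multiplicity p (order G) * m"
    using multiplicity_dvd by blast
  then show ?thesis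
    using sylow_thm[OF assms(2) is_group _ assms(1)] unfolding sylow_subgroup_def by blast
qed

end

theory Submission
  imports Defs
begin

text \<open>
  The product of all elements of \<open>G\<close> is the unique involution \<open>z\<close> if there is exactly one, and
  \<open>1\<close> otherwise, and having exactly one involution means that the Sylow 2-subgroups are nontrivial
  and cyclic. If the product is \<open>1\<close>, Marshall Hall's theorem on differences of two enumerations of an
  abelian group gives a transversal, and its translates partition the table.

  If there is a unique involution, no transversal exists, so every colour class has at most
  \<open>n - 1\<close> cells and \<open>(n + 1) (n - 1) < n\<^sup>2\<close> excludes \<open>n + 1\<close> colours. For the upper bound, choose a
  cyclic arrangement \<open>w\<close> of \<open>G\<close> that is shifted by \<open>z\<close> after half a period and whose consecutive products
  \<open>w t w (t + 1)\<close> repeat only with the half period. For every square \<open>c\<close> the cells \<open>(w t, w t c)\<close> and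
  \<open>(w t, w (t + 1) c)\<close> form a Moebius ladder, which becomes bipartite after the removal of two suitable
  cells; the position of the removed pair is free. The \<open>n / 2\<close> ladders cover the table and give \<open>n\<close>
  partial transversals. It remains to choose the positions so that the removed cells form two more
  partial transversals. This is reduced to an arithmetical choice in a cyclic quotient of \<open>G\<close> by
  passing to a maximal subgroup \<open>H\<close> of odd order having a map \<open>f\<close> for which \<open>f k\<close>, \<open>f k k\<close> and
  \<open>f k f k k\<close> are injective: such a map extends to cyclic extensions of prime order at least 5
  and to extensions by two factors of order 3, and therefore \<open>G / H\<close> is cyclic.
\<close>

section \<open>Colourings of latin squares and Cayley tables\<close>

lemma partial_transversal_subset:
  "partial_transversal n L T \<Longrightarrow> S \<subseteq> T \<Longrightarrow> partial_transversal n L S"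
  unfolding partial_transversal_def by (blast intro: inj_on_subset)

text \<open>Subsets of partial transversals are partial transversals, so a cover is enough:
  \<open>f\<close> picks one member of the cover for each cell, and the nonempty fibres of
  \<open>f\<close> are the classes of a partition.\<close>

lemma latin_chromatic_number_le:
  assumes fin: "finite \<T>" and T: "\<And>T. T \<in> \<T> \<Longrightarrow> partial_transversal n L T"
    and cover: "cells n \<subseteq> \<Union>\<T>"
  shows "latin_chromatic_number n L \<le> card \<T>"
proof -
  have "\<exists>f. \<forall>x\<in>cells n. x \<in> f x \<and> f x \<in> \<T>"
    using cover by (intro bchoice) blast
  then obtain f where f: "\<And>x. x \<in> cells n \<Longrightarrow> x \<in> f x \<and> f x \<in> \<T>"
    by blast
  define \<C> where "\<C> = (\<lambda>T. {x \<in> cells n. f x = T}) ` f ` cells n"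
  have "partition_on (cells n) \<C>"
    unfolding \<C>_def partition_on_def disjoint_def by auto
  moreover have "partial_transversal n L C" if "C \<in> \<C>" for C
    using that f unfolding \<C>_def by (auto intro!: partial_transversal_subset[OF T])
  ultimately have "latin_coloring n L (card \<C>) \<C>"
    by (auto simp: latin_coloring_def)
  then have "latin_chromatic_number n L \<le> card \<C>"
    unfolding latin_chromatic_number_def by (blast intro: Least_le)
  also have "\<dots> \<le> card (f ` cells n)"
    unfolding \<C>_def by (intro card_image_le) (simp add: cells_def)
  also have "\<dots> \<le> card \<T>"
    using f fin by (intro card_mono) auto
  finally show ?thesis .
qed

text \<open>Counting the cells class by class in an optimal coloring.\<close>

lemma latin_chromatic_number_ge:
  assumes s: "\<And>T. partial_transversal n L T \<Longrightarrow> card T \<le> s"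
  shows "n * n \<le> latin_chromatic_number n L * s"
proof -
  obtain \<C> where \<C>: "latin_coloring n L (latin_chromatic_number n L) \<C>"
    using LeastI_ex[OF latin_coloring_exists[of n L]] latin_chromatic_number_def[of n L] by auto
  then have p: "partition_on (cells n) \<C>" and c: "card \<C> = latin_chromatic_number n L"
    by (auto simp: latin_coloring_def)
  have fin: "finite (cells n)"
    by (simp add: cells_def)
  have p': "\<Union>\<C> = cells n" "pairwise disjnt \<C>"
    using p by (auto simp: partition_on_def disjoint_def pairwise_def disjnt_def)
  have "n * n = card (cells n)"
    by (simp add: cells_def)
  also have "\<dots> = (\<Sum>T\<in>\<C>. card T)"
    using p' card_Union_disjoint[of \<C>] by (metis Sup_upper fin finite_subset)
  also have "\<dots> \<le> (\<Sum>T\<in>\<C>. s)"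
    using \<C> s by (intro sum_mono) (simp add: latin_coloring_def)
  finally show ?thesis
    using c by simp
qed

lemma card_partial_transversal_le: "partial_transversal n L T \<Longrightarrow> card T \<le> n"
  by (rule card_inj_on_le[of fst T "{..<n}", simplified]) (auto simp: partial_transversal_def cells_def)

section \<open>Transversals of Cayley tables as sets of pairs of group elements\<close>

definition cayley_transversal :: "('a, 'b) monoid_scheme \<Rightarrow> ('a \<times> 'a) set \<Rightarrow> bool" where
  "cayley_transversal G S \<longleftrightarrow> S \<subseteq> carrier G \<times> carrier G \<and> inj_on fst S \<and> inj_on snd S \<and>
     inj_on (\<lambda>(x, y). x \<otimes>\<^bsub>G\<^esub> y) S"

lemma partial_transversalI:
  assumes "T \<subseteq> cells n"
    and "\<And>i j k l. (i, j) \<in> T \<Longrightarrow> (k, l) \<in> T \<Longrightarrow> i = k \<or> j = l \<or> L i j = L k l \<Longrightarrow> i = k \<and> j = l"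
  shows "partial_transversal n L T"
proof -
  have "inj_on fst T" "inj_on snd T"
    by (auto intro!: inj_onI dest: assms(2))
  moreover have "inj_on (\<lambda>(i, j). L i j) T"
    unfolding inj_on_def using assms(2) by fast
  ultimately show ?thesis
    using assms(1) by (simp add: partial_transversal_def)
qed

lemma cayley_transversalI:
  assumes "\<And>x y. (x, y) \<in> S \<Longrightarrow> x \<in> carrier G \<and> y \<in> carrier G"
    and "\<And>x y u v. (x, y) \<in> S \<Longrightarrow> (u, v) \<in> S \<Longrightarrow> x = u \<or> y = v \<or> x \<otimes>\<^bsub>G\<^esub> y = u \<otimes>\<^bsub>G\<^esub> v \<Longrightarrow>
      x = u \<and> y = v"
  shows "cayley_transversal G S"
proof -
  have "inj_on fst S" "inj_on snd S"
    by (auto intro!: inj_onI dest: assms(2))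
  moreover have "inj_on (\<lambda>(x, y). x \<otimes>\<^bsub>G\<^esub> y) S"
    unfolding inj_on_def using assms(2) by fast
  ultimately show ?thesis
    using assms(1) by (auto simp: cayley_transversal_def)
qed

lemma cayley_transversalD:
  assumes "cayley_transversal G S" "(x, y) \<in> S" "(u, v) \<in> S"
    and "x = u \<or> y = v \<or> x \<otimes>\<^bsub>G\<^esub> y = u \<otimes>\<^bsub>G\<^esub> v"
  shows "x = u \<and> y = v"
proof -
  have f: "inj_on fst S" and s: "inj_on snd S" and m: "inj_on (\<lambda>(x, y). x \<otimes>\<^bsub>G\<^esub> y) S"
    using assms(1) by (simp_all add: cayley_transversal_def)
  from assms(4) have "(x, y) = (u, v)"
  proof (elim disjE)
    assume "x = u" then show ?thesis
      using assms(2,3) by (intro inj_onD[OF f]) auto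
  next
    assume "y = v" then show ?thesis
      using assms(2,3) by (intro inj_onD[OF s]) auto
  next
    assume "x \<otimes>\<^bsub>G\<^esub> y = u \<otimes>\<^bsub>G\<^esub> v" then show ?thesis
      using assms(2,3) by (intro inj_onD[OF m]) auto
  qed
  then show ?thesis
    by simp
qed

text \<open>This removes the enumeration: afterwards cells are pairs of group elements instead of
  pairs of indices. As \<open>g\<close> is bijective, the preimage of a transversal is again
  one.\<close>

lemma cayley_chromatic_le:
  assumes g: "bij_betw g {..<n} (carrier G)" and fin: "finite \<S>"
    and S: "\<And>S. S \<in> \<S> \<Longrightarrow> cayley_transversal G S"
    and cover: "carrier G \<times> carrier G \<subseteq> \<Union>\<S>"
  shows "latin_chromatic_number n (cayley_table G g) \<le> card \<S>"
proof -
  define pull where "pull S = {(i, j). (i, j) \<in> cells n \<and> (g i, g j) \<in> S}" for S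
  have inj: "g i = g j \<longleftrightarrow> i = j" if "i < n" "j < n" for i j
    using g that by (auto simp: bij_betw_def inj_on_def)
  have "partial_transversal n (cayley_table G g) (pull S)" if "S \<in> \<S>" for S
  proof -
    show ?thesis
    proof (rule partial_transversalI)
      show "pull S \<subseteq> cells n"
        by (auto simp: pull_def)
    next
      fix i j k l
      assume "(i, j) \<in> pull S" "(k, l) \<in> pull S"
        and *: "i = k \<or> j = l \<or> cayley_table G g i j = cayley_table G g k l"
      then have "(g i, g j) \<in> S" "(g k, g l) \<in> S" "i < n" "j < n" "k < n" "l < n"
        by (simp_all add: pull_def cells_def)
      moreover from this have "g i = g k \<and> g j = g l"
        using * by (intro cayley_transversalD[OF S[OF that]]) (auto simp: cayley_table_def)
      ultimately show "i = k \<and> j = l"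
        by (simp add: inj)
    qed
  qed
  moreover have "cells n \<subseteq> \<Union>(pull ` \<S>)"
  proof clarify
    fix i j assume ij: "(i, j) \<in> cells n"
    then have "(g i, g j) \<in> carrier G \<times> carrier G"
      using bij_betwE[OF g] by (auto simp: cells_def)
    then obtain S where "S \<in> \<S>" "(g i, g j) \<in> S"
      using cover by blast
    with ij show "(i, j) \<in> \<Union>(pull ` \<S>)"
      by (auto simp: pull_def)
  qed
  ultimately have "latin_chromatic_number n (cayley_table G g) \<le> card (pull ` \<S>)"
    using fin by (intro latin_chromatic_number_le) auto
  also have "\<dots> \<le> card \<S>"
    using fin by (rule card_image_le)
  finally show ?thesis .
qed

section \<open>Hall's theorem and products over the group\<close>

context comm_group
begin

lemma mult_inv_cancel_left:
  "x \<in> carrier G \<Longrightarrow> y \<in> carrier G \<Longrightarrow> x \<otimes> (inv x \<otimes> y) = y"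
  by (simp add: m_assoc[symmetric])

text \<open>Supplies the induction step of Hall's theorem. Values are shifted along one orbit of the
  permutation \<open>\<sigma>\<close>, from \<open>q\<close> to its first return to
  \<open>{p, q}\<close>; this only rearranges both enumerations, and the entries freed at
  \<open>p\<close> and \<open>q\<close> fit the altered quotients.\<close>

lemma hall_exchange:
  assumes fin: "finite I" and x: "bij_betw x I (carrier G)" and y: "bij_betw y I (carrier G)"
    and b: "\<And>i. i \<in> I \<Longrightarrow> b i \<in> carrier G" and xy: "\<And>i. i \<in> I \<Longrightarrow> y i = x i \<otimes> b i"
    and pq: "p \<in> I" "q \<in> I" "p \<noteq> q"
    and b': "b' p \<in> carrier G" "b' q \<in> carrier G" "b' p \<otimes> b' q = b p \<otimes> b q"
      "\<And>i. i \<in> I \<Longrightarrow> i \<noteq> p \<Longrightarrow> i \<noteq> q \<Longrightarrow> b' i = b i"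
  shows "\<exists>x' y'. bij_betw x' I (carrier G) \<and> bij_betw y' I (carrier G) \<and>
    (\<forall>i\<in>I. y' i = x' i \<otimes> b' i)"
proof -
  have xc [simp]: "x i \<in> carrier G" and yc [simp]: "y i \<in> carrier G" if "i \<in> I" for i
    using x y that by (auto simp: bij_betw_def)
  \<comment> \<open>Forced by the wish to keep \<open>x p\<close>: now
    \<open>x p \<otimes> b' p\<close> equals \<open>C \<otimes> inv (x q)\<close>, which is the
    value of \<open>y\<close> at \<open>\<sigma> q\<close>.\<close>
  define C where "C = b' p \<otimes> x p \<otimes> x q"
  have C [simp]: "C \<in> carrier G"
    using pq b' by (simp add: C_def)
  define \<sigma> where "\<sigma> i = inv_into I y (C \<otimes> inv (x i))" for i
  have \<sigma>I [simp]: "\<sigma> i \<in> I" and y\<sigma>: "y (\<sigma> i) = C \<otimes> inv (x i)" if "i \<in> I" for i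
    using y that by (auto simp: \<sigma>_def bij_betw_def inv_into_into f_inv_into_f)
  have x\<sigma>: "x i = C \<otimes> inv (y (\<sigma> i))" if "i \<in> I" for i
    using that by (simp add: y\<sigma> inv_mult m_assoc[symmetric])
  have \<sigma>inj: "i = j" if "\<sigma> i = \<sigma> j" "i \<in> I" "j \<in> I" for i j
    using that x\<sigma> x by (metis bij_betw_inv_into_left)
  define s where "s k = (\<sigma> ^^ k) q" for k
  have s0: "s 0 = q" and sS: "s (Suc k) = \<sigma> (s k)" for k
    by (simp_all add: s_def)
  have sI [simp]: "s k \<in> I" for k
    by (induction k) (simp_all add: s0 sS pq)
  have sd: "s d = q" if "s (i + d) = s i" for i d
    using that by (induction i) (auto simp: s0 sS dest: \<sigma>inj)
  have "\<not> inj_on s UNIV"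
    using fin sI by (metis finite_imageD finite_subset image_subsetI infinite_UNIV_nat)
  then obtain i j where "s i = s j" "i < j"
    unfolding inj_on_def by (metis nat_neq_iff)
  then have "s (j - i) = q" "j - i \<ge> 1"
    using sd[of i "j - i"] by auto
  then have ex: "\<exists>k. k \<ge> 1 \<and> s k \<in> {p, q}"
    by blast
  \<comment> \<open>The orbit of \<open>q\<close> under an injective map of a finite set returns to
    \<open>q\<close>, so a first positive time in \<open>{p, q}\<close> exists. The walk may end at
    either index; \<open>r\<close> below is the other one.\<close>
  define L where "L = (LEAST k. k \<ge> 1 \<and> s k \<in> {p, q})"
  have L: "L \<ge> 1" "s L \<in> {p, q}"
    using LeastI_ex[OF ex] by (auto simp: L_def)
  have notpq: "s k \<notin> {p, q}" if "1 \<le> k" "k < L" for k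
    using not_less_Least[of k "\<lambda>k. k \<ge> 1 \<and> s k \<in> {p, q}"] that by (auto simp: L_def)
  define J where "J = s ` {1..<L}"
  have J: "p \<notin> J" "q \<notin> J"
    using notpq by (fastforce simp: J_def)+
  define r where "r = (if s L = p then q else p)"
  have r: "r \<in> I" "{s L, r} = {p, q}"
    using L pq by (auto simp: r_def)
  \<comment> \<open>Reflecting a pair \<open>(x i, y i)\<close> to \<open>(C / y i, C / x i)\<close> keeps its quotient \<open>b i\<close>; doing so along
    the orbit \<open>J\<close> only rearranges the values.\<close>
  define x' where "x' i = (if i \<in> J then C \<otimes> inv (y i) else if i = q then x (s (L - 1)) else x i)" for i
  define y' where "y' i = (if i \<in> J then C \<otimes> inv (x i) else if i = p then C \<otimes> inv (x q)
    else if i = q then y r else y i)" for i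
  have JI: "J \<subseteq> I"
    by (auto simp: J_def)
  have surj_x: "carrier G \<subseteq> x' ` I"
  proof
    fix a assume "a \<in> carrier G"
    then obtain i where i: "i \<in> I" "a = x i"
      using x by (auto simp: bij_betw_def)
    show "a \<in> x' ` I"
    proof (cases "i \<in> s ` {0..<L}")
      case True
      then obtain k where k: "i = s k" "k < L"
        by auto
      show ?thesis
      proof (cases "Suc k < L")
        case True
        then have "s (Suc k) \<in> J"
          by (auto simp: J_def)
        then have "x' (s (Suc k)) = a"
          by (simp add: x'_def i k sS x\<sigma>[symmetric])
        then show ?thesis
          by (metis imageI sI)
      next
        case False
        then have "k = L - 1"
          using k by simp
        then have "x' q = a"
          using J i k by (simp add: x'_def)
        then show ?thesis
          using pq by blast
      qed
    next
      case False
      then have "i \<notin> J" "i \<noteq> q"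
        using L s0 by (force simp: J_def)+
      then have "x' i = a"
        by (simp add: x'_def i)
      then show ?thesis
        using i by blast
    qed
  qed
  have surj_y: "carrier G \<subseteq> y' ` I"
  proof
    fix a assume "a \<in> carrier G"
    then obtain i where i: "i \<in> I" "a = y i"
      using y by (auto simp: bij_betw_def)
    show "a \<in> y' ` I"
    proof (cases "i \<in> s ` {1..L}")
      case True
      then obtain k where k: "i = s k" "1 \<le> k" "k \<le> L"
        by auto
      show ?thesis
      proof (cases "k = 1")
        case True
        then have "y' p = a"
          using J i k pq sS[of 0] by (simp add: y'_def y\<sigma> s0)
        then show ?thesis
          using pq by blast
      next
        case False
        then have "s (k - 1) \<in> J"
          using k unfolding J_def by (intro imageI) auto
        moreover have "i = \<sigma> (s (k - 1))"
          using k sS[of "k - 1"] by simp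
        ultimately have "y' (s (k - 1)) = a"
          by (simp add: y'_def i y\<sigma>)
        then show ?thesis
          by (metis imageI sI)
      qed
    next
      case False
      then have iJ: "i \<notin> J" and "i \<noteq> s L"
        using L by (auto simp: J_def)
      show ?thesis
      proof (cases "i = r")
        case True
        then have "y' q = a"
          using J i pq by (simp add: y'_def)
        then show ?thesis
          using pq by blast
      next
        case False
        then have "i \<noteq> p" "i \<noteq> q"
          using r(2) \<open>i \<noteq> s L\<close> by auto
        then have "y' i = a"
          by (simp add: y'_def i iJ)
        then show ?thesis
          using i by blast
      qed
    qed
  qed
  have x'c: "x' i \<in> carrier G" and y'c: "y' i \<in> carrier G" if "i \<in> I" for i
    using that pq r by (auto simp: x'_def y'_def)
  have card: "card I = card (carrier G)"
    using x by (rule bij_betw_same_card)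
  have "bij_betw x' I (carrier G)" "bij_betw y' I (carrier G)"
    unfolding bij_betw_def using surj_x surj_y x'c y'c fin card
    by (auto intro!: eq_card_imp_inj_on) (metis image_subset_iff subset_antisym)+
  moreover have "y' i = x' i \<otimes> b' i" if i: "i \<in> I" for i
  proof -
    consider "i \<in> J" | "i = p" | "i = q" | "i \<notin> J" "i \<noteq> p" "i \<noteq> q"
      by blast
    then show ?thesis
    proof cases
      case 1
      have "b' i = b i"
        using 1 J b'(4) i by metis
      moreover have "inv (x i) = inv (y i) \<otimes> b i"
        using i b xy[OF i] by (simp add: inv_mult m_ac mult_inv_cancel_left)
      ultimately show ?thesis
        using 1 i b by (simp add: x'_def y'_def m_assoc)
    next
      case 2
      then show ?thesis
        using J pq b' by (simp add: x'_def y'_def C_def m_ac)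
    next
      case 3
      \<comment> \<open>Here the preserved product \<open>b' p \<otimes> b' q\<close> enters:
        \<open>y r\<close> and \<open>y (s L)\<close> are \<open>y p\<close> and \<open>y q\<close>
        in some order, and this closes the relation at \<open>q\<close>.\<close>
      have "y r \<otimes> y (s L) = y p \<otimes> y q"
        using r(2) pq by (auto simp: doubleton_eq_iff m_comm)
      also have "\<dots> = x p \<otimes> x q \<otimes> (b p \<otimes> b q)"
        using pq b by (simp add: xy m_ac)
      also have "\<dots> = C \<otimes> b' q"
        using pq b b' by (simp add: b'(3)[symmetric] C_def m_ac)
      finally have *: "y r \<otimes> y (s L) = C \<otimes> b' q" .
      have "x (s (L - 1)) = C \<otimes> inv (y (s L))"
        using x\<sigma>[of "s (L - 1)"] sS[of "L - 1"] L by simp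
      then have "x (s (L - 1)) \<otimes> b' q = (C \<otimes> b' q) \<otimes> inv (y (s L))"
        using b' by (simp add: m_ac)
      also have "\<dots> = y r"
        using r by (simp add: *[symmetric] m_assoc)
      finally show ?thesis
        using 3 J pq by (simp add: x'_def y'_def)
    next
      case 4
      then show ?thesis
        using i b' by (simp add: x'_def y'_def xy)
    qed
  qed
  ultimately show ?thesis
    by blast
qed

theorem hall_difference_representation:
  fixes n :: nat
  assumes e: "bij_betw e {..<n} (carrier G)" and b: "\<And>i. i < n \<Longrightarrow> b i \<in> carrier G"
    and prod: "finprod G b {..<n} = \<one>"
  shows "\<exists>x y. bij_betw x {..<n} (carrier G) \<and> bij_betw y {..<n} (carrier G) \<and>
    (\<forall>i<n. y i = x i \<otimes> b i)"
proof -
  \<comment> \<open>\<open>B s\<close> agrees with \<open>b\<close> below \<open>s\<close>, corrects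
    the total product to one at \<open>s\<close>, and is one afterwards. \<open>B 0\<close> is
    solved by taking \<open>e\<close> twice; the passage to \<open>B (Suc s)\<close> alters only the
    places \<open>s\<close> and \<open>Suc s\<close> and keeps their product.\<close>
  define B where "B s i = (if i < s then b i else if i = s then inv (finprod G b {..<s}) else \<one>)"
    for s i
  have B: "B s i \<in> carrier G" if "s < n" "i < n" for s i
    using that b by (auto simp: B_def intro!: finprod_closed)
  have "\<exists>x y. bij_betw x {..<n} (carrier G) \<and> bij_betw y {..<n} (carrier G) \<and>
    (\<forall>i\<in>{..<n}. y i = x i \<otimes> B s i)" if "s < n" for s
    using that
  proof (induction s)
    case 0
    have "e i = e i \<otimes> B 0 i" if "i < n" for i
      using bij_betwE[OF e] that by (auto simp: B_def)
    then show ?case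
      using e by blast
  next
    case (Suc s)
    then obtain x y where xy: "bij_betw x {..<n} (carrier G)" "bij_betw y {..<n} (carrier G)"
      "\<And>i. i \<in> {..<n} \<Longrightarrow> y i = x i \<otimes> B s i"
      by force
    have P: "finprod G b {..<s} \<in> carrier G" "b s \<in> carrier G"
      using b Suc.prems by (auto intro!: finprod_closed)
    have PS: "finprod G b {..<Suc s} = b s \<otimes> finprod G b {..<s}"
      using b Suc.prems P by (simp add: lessThan_Suc Pi_def)
    show ?case
    proof (rule hall_exchange[OF _ xy(1,2) _ xy(3), of s "Suc s"])
      show "B (Suc s) s \<otimes> B (Suc s) (Suc s) = B s s \<otimes> B s (Suc s)"
        using P by (simp add: B_def PS inv_mult m_assoc[symmetric])
    next
      show "B (Suc s) s \<in> carrier G" "B (Suc s) (Suc s) \<in> carrier G"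
        using Suc.prems B by auto
    qed (use Suc.prems B in \<open>auto simp: B_def\<close>)
  qed
  moreover have "n > 0"
    using e by (cases n) (auto simp: bij_betw_def)
  \<comment> \<open>The last entry, which absorbs the defect, has the right value because the total
    product is one.\<close>
  moreover have "B (n - 1) i = b i" if "i < n" for i
  proof (cases "i = n - 1")
    case True
    have P: "finprod G b {..<n - 1} \<in> carrier G" "b (n - 1) \<in> carrier G"
      using b \<open>n > 0\<close> by (auto intro!: finprod_closed)
    have "finprod G b {..<Suc (n - 1)} = b (n - 1) \<otimes> finprod G b {..<n - 1}"
      using b P \<open>n > 0\<close> by (subst lessThan_Suc, subst finprod_insert) auto
    then have "b (n - 1) \<otimes> finprod G b {..<n - 1} = \<one>"
      using prod \<open>n > 0\<close> by simp
    then show ?thesis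
      using P True by (simp add: B_def inv_equality)
  qed (use that in \<open>auto simp: B_def\<close>)
  ultimately show ?thesis
    by (metis diff_less lessThan_iff zero_less_one)
qed

section \<open>Products over paired sets and over the whole group\<close>

lemma finprod_fixpoint_free_involution:
  assumes "finite A" and "\<And>a. a \<in> A \<Longrightarrow> f a \<in> carrier G"
    and "\<And>a. a \<in> A \<Longrightarrow> \<iota> a \<in> A \<and> \<iota> (\<iota> a) = a \<and> \<iota> a \<noteq> a \<and> f a \<otimes> f (\<iota> a) = u"
    and u: "u \<in> carrier G" "u \<otimes> u = \<one>"
  shows "finprod G f A \<in> {\<one>, u}"
  using assms(1-3)
proof (induction A rule: finite_psubset_induct)
  case (psubset A)
  show ?case
  proof (cases "A = {}")
    case False
    then obtain a where a: "a \<in> A"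
      by blast
    let ?B = "A - {a, \<iota> a}"
    have i: "\<iota> a \<in> A" "\<iota> (\<iota> a) = a" "\<iota> a \<noteq> a" "f a \<otimes> f (\<iota> a) = u"
      using psubset.prems(2)[OF a] by auto
    \<comment> \<open>Without the pair of \<open>a\<close> the set is still stable under
      \<open>\<iota>\<close>. Each pair contributes a factor \<open>u\<close>, and \<open>u\<close>
      squares to one.\<close>
    have B: "finprod G f ?B \<in> {\<one>, u}"
    proof (rule psubset.IH)
      show "?B \<subset> A"
        using a by blast
      show "f b \<in> carrier G" if "b \<in> ?B" for b
        using that psubset.prems(1) by blast
      show "\<iota> b \<in> ?B \<and> \<iota> (\<iota> b) = b \<and> \<iota> b \<noteq> b \<and> f b \<otimes> f (\<iota> b) = u" if "b \<in> ?B" for b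
        using that psubset.prems(2)[of b] i by (metis DiffD1 DiffD2 DiffI insert_iff empty_iff)
    qed
    have "A = insert a (insert (\<iota> a) ?B)"
      using a i by blast
    then have "finprod G f A = finprod G f (insert a (insert (\<iota> a) ?B))"
      by simp
    also have "\<dots> = f a \<otimes> (f (\<iota> a) \<otimes> finprod G f ?B)"
      using psubset.hyps i psubset.prems(1) a by (subst finprod_insert, simp, simp, simp add: Pi_def, simp, subst finprod_insert) auto
    also have "\<dots> = u \<otimes> finprod G f ?B"
      using i(4) a i(1) psubset.prems(1) B u by (subst m_assoc[symmetric]) auto
    finally show ?thesis
      using B u by auto
  qed simp
qed

text \<open>Elements different from their inverses cancel against them.\<close>

lemma finprod_carrier_eq_finprod_involutions:
  assumes fin: "finite (carrier G)"
  shows "finprod G (\<lambda>x. x) (carrier G) = finprod G (\<lambda>x. x) {x \<in> carrier G. x \<otimes> x = \<one>}"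
proof -
  let ?V = "{x \<in> carrier G. x \<otimes> x = \<one>}"
  let ?W = "carrier G - ?V"
  have W: "finprod G (\<lambda>x. x) ?W = \<one>"
  proof -
    have "finprod G (\<lambda>x. x) ?W \<in> {\<one>, \<one>}"
    proof (rule finprod_fixpoint_free_involution[where \<iota> = "\<lambda>x. inv x"])
      fix a assume a: "a \<in> ?W"
      have "inv a \<noteq> a"
        using a by (metis (mono_tags, lifting) DiffE mem_Collect_eq r_inv)
      moreover have "inv a \<otimes> inv a \<noteq> \<one>"
        using a by (metis (mono_tags, lifting) DiffE inv_equality inv_inv inv_closed mem_Collect_eq r_inv)
      ultimately show "inv a \<in> ?W \<and> inv (inv a) = a \<and> inv a \<noteq> a \<and> a \<otimes> inv a = \<one>"
        using a by simp
    qed (use fin in auto)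
    then show ?thesis
      by simp
  qed
  have "finprod G (\<lambda>x. x) (?V \<union> ?W) = finprod G (\<lambda>x. x) ?V \<otimes> finprod G (\<lambda>x. x) ?W"
    using fin by (intro finprod_Un_disjoint) auto
  moreover have "?V \<union> ?W = carrier G"
    by blast
  ultimately show ?thesis
    using W by simp
qed

lemma finprod_carrier_unique_involution:
  assumes fin: "finite (carrier G)" and z: "z \<in> carrier G" "z \<otimes> z = \<one>" "z \<noteq> \<one>"
    and uniq: "\<And>u. u \<in> carrier G \<Longrightarrow> u \<otimes> u = \<one> \<Longrightarrow> u = \<one> \<or> u = z"
  shows "finprod G (\<lambda>x. x) (carrier G) = z"
proof -
  have "{x \<in> carrier G. x \<otimes> x = \<one>} = {\<one>, z}"
    using z uniq by auto
  then show ?thesis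
    using z by (simp add: finprod_carrier_eq_finprod_involutions[OF fin] Pi_def)
qed

text \<open>Translation by an involution \<open>w\<close> pairs the solutions of
  \<open>x \<otimes> x = \<one>\<close> with product \<open>w\<close> in each pair, so their product
  is \<open>\<one>\<close> or \<open>w\<close>. Two different involutions leave only
  \<open>\<one>\<close>.\<close>

lemma finprod_carrier_eq_one:
  assumes fin: "finite (carrier G)" and "\<nexists>!z. z \<in> carrier G \<and> z \<otimes> z = \<one> \<and> z \<noteq> \<one>"
  shows "finprod G (\<lambda>x. x) (carrier G) = \<one>"
proof (cases "\<exists>z. z \<in> carrier G \<and> z \<otimes> z = \<one> \<and> z \<noteq> \<one>")
  case False
  then have "x = \<one>" if "x \<in> carrier G" "x \<otimes> x = \<one>" for x
    using that by blast
  then have "{x \<in> carrier G. x \<otimes> x = \<one>} = {\<one>}"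
    by (intro equalityI subsetI) simp_all
  then show ?thesis
    by (simp add: finprod_carrier_eq_finprod_involutions[OF fin] Pi_def)
next
  case True
  then obtain u where u: "u \<in> carrier G" "u \<otimes> u = \<one>" "u \<noteq> \<one>"
    by blast
  have "\<exists>v. v \<in> carrier G \<and> v \<otimes> v = \<one> \<and> v \<noteq> \<one> \<and> v \<noteq> u"
  proof (rule ccontr)
    assume "\<not> ?thesis"
    then have "\<exists>!z. z \<in> carrier G \<and> z \<otimes> z = \<one> \<and> z \<noteq> \<one>"
      using u by (intro ex1I[of _ u]) auto
    then show False
      using assms(2) by contradiction
  qed
  then obtain v where v: "v \<in> carrier G" "v \<otimes> v = \<one>" "v \<noteq> \<one>" and "v \<noteq> u"
    by blast
  let ?V = "{x \<in> carrier G. x \<otimes> x = \<one>}"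
  have "finprod G (\<lambda>x. x) ?V \<in> {\<one>, w}" if w: "w \<in> carrier G" "w \<otimes> w = \<one>" "w \<noteq> \<one>" for w
  proof (rule finprod_fixpoint_free_involution[where \<iota> = "\<lambda>x. x \<otimes> w"])
    fix a assume a: "a \<in> ?V"
    then have a': "a \<in> carrier G" "a \<otimes> a = \<one>"
      by simp_all
    have "a \<otimes> w \<otimes> (a \<otimes> w) = (a \<otimes> a) \<otimes> (w \<otimes> w)" "a \<otimes> (a \<otimes> w) = (a \<otimes> a) \<otimes> w"
      "a \<otimes> w \<otimes> w = a \<otimes> (w \<otimes> w)"
      using a'(1) w(1) by (simp_all add: m_ac)
    then show "a \<otimes> w \<in> ?V \<and> a \<otimes> w \<otimes> w = a \<and> a \<otimes> w \<noteq> a \<and> a \<otimes> (a \<otimes> w) = w"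
      using a' w by simp
  qed (use fin w in auto)
  from this[OF u] this[OF v] \<open>v \<noteq> u\<close> show ?thesis
    by (auto simp: finprod_carrier_eq_finprod_involutions[OF fin])
qed

end

section \<open>Integers\<close>

lemma int_dvd_diff_imp_eq:
  fixes i j b :: int
  assumes "b dvd i - j" "i \<in> {0..<b}" "j \<in> {0..<b}"
  shows "i = j"
  using assms by (metis atLeastLessThan_iff mod_eq_dvd_iff mod_pos_pos_trivial)

lemma int_add_no_carry:
  fixes t b k :: int
  assumes "0 \<le> t mod b + k" "t mod b + k < b"
  shows "(t + k) mod b = t mod b + k" "(t + k) div b = t div b"
proof -
  have *: "t + k = b * (t div b) + (t mod b + k)"
    by simp
  show "(t + k) mod b = t mod b + k"
    by (rule int_mod_pos_eq[OF * assms])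
  show "(t + k) div b = t div b"
    by (rule int_div_pos_eq[OF * assms])
qed

lemma int_add_carry:
  fixes t b :: int
  assumes "0 < b" "t mod b = b - 1"
  shows "(t + 1) mod b = 0" "(t + 1) div b = t div b + 1"
proof -
  have "b * (t div b) + t mod b = t"
    by simp
  then have "t + 1 = b * (t div b + 1) + 0"
    using assms(2) by (simp add: distrib_left)
  then show "(t + 1) mod b = 0" "(t + 1) div b = t div b + 1"
    using assms(1) int_mod_pos_eq[of "t + 1" b "t div b + 1" 0] int_div_pos_eq[of "t + 1" b "t div b + 1" 0]
    by simp_all
qed

text \<open>Invertibility modulo 3 of the linear maps that occur in
  \<open>strong_map_adjoin_two\<close>.\<close>

lemma three_dvd_linear:
  fixes u v :: int
  shows "3 dvd 2 * v \<Longrightarrow> 3 dvd v"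
    and "3 dvd u + 2 * v \<Longrightarrow> 3 dvd u + v \<Longrightarrow> 3 dvd u \<and> 3 dvd v"
    and "3 dvd u + 4 * v \<Longrightarrow> 3 dvd 2 * u + v \<Longrightarrow> 3 dvd u \<and> 3 dvd v"
  by presburger+

text \<open>Let \<open>t\<close> be the product of the primes dividing \<open>N\<close> that differ
  from \<open>p\<close> and do not divide \<open>l\<close>. Then every prime divisor of
  \<open>N\<close> divides exactly one of the two summands \<open>l\<close> and
  \<open>int p * t\<close>.\<close>

lemma coprime_shift_exists:
  fixes l N :: int and p :: nat
  assumes "Factorial_Ring.prime p" "N > 0" "\<not> (int p dvd l \<and> int p dvd N)"
  shows "\<exists>t. coprime (l + int p * t) N"
proof -
  define S where "S = {q. Factorial_Ring.prime q \<and> q dvd N \<and> \<not> q dvd l \<and> q \<noteq> int p}"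
  have fin: "finite S"
    using assms(2) finite_divisors_int[of N] by (auto simp: S_def intro: finite_subset)
  define t where "t = \<Prod>S"
  have *: "\<not> q dvd l + int p * t" if q: "Factorial_Ring.prime q" "q dvd N" for q
  proof (cases "q = int p")
    case True
    then show ?thesis
      using assms(3) q by (simp add: dvd_add_left_iff)
  next
    case False
    show ?thesis
    proof (cases "q dvd l")
      case True
      have "\<not> q dvd t"
      proof
        assume "q dvd t"
        then obtain r where "r \<in> S" "q dvd r"
          using prime_dvd_prod_iff[OF fin q(1), of id] by (auto simp: t_def)
        then show False
          using True q primes_dvd_imp_eq[of q r] by (auto simp: S_def)
      qed
      moreover have "\<not> q dvd int p"
        using False q assms(1) primes_dvd_imp_eq[of q "int p"] by auto
      ultimately show ?thesis
        using True q by (simp add: dvd_add_right_iff prime_dvd_mult_iff)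
    next
      case False2: False
      then have "q \<in> S"
        using q False by (simp add: S_def)
      then have "q dvd t"
        unfolding t_def using fin by (simp add: dvd_prodI[of S q id, simplified])
      then show ?thesis
        using False2 by (simp add: dvd_add_left_iff)
    qed
  qed
  have "coprime (l + int p * t) N"
  proof (rule ccontr)
    let ?g = "gcd (l + int p * t) N"
    assume "\<not> coprime (l + int p * t) N"
    then have "\<not> is_unit ?g"
      by (simp add: coprime_iff_gcd_eq_1)
    moreover have "?g \<noteq> 0"
      using assms(2) by simp
    ultimately obtain q where "q dvd ?g" "Factorial_Ring.prime q"
      using prime_divisor_exists by blast
    then show False
      using *[of q] by simp
  qed
  then show ?thesis ..
qed

text \<open>
  In the quotient of order \<open>2 M\<close>, the ladders over \<open>2 e\<close> are cut at level \<open>A e\<close>, and \<open>d e\<close> tells which of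
  the two conflicting cells of the column is removed. The three differences compare the rows, columns
  and symbols of the removed cells.
\<close>

lemma selection_exists:
  fixes M :: int
  assumes "M \<ge> 1"
  shows "\<exists>A d. (\<forall>e\<in>{0..<M}. d e \<in> {0, 1} \<and> (d e = 1 \<longrightarrow> \<not> M dvd A e)) \<and>
    (\<forall>e\<in>{0..<M}. \<forall>e'\<in>{0..<M}.
       2 * M dvd (A e - d e) - (A e' - d e') \<or>
       2 * M dvd (A e + 2 * e) - (A e' + 2 * e') \<or>
       2 * M dvd (2 * A e + 2 * e - d e) - (2 * A e' + 2 * e' - d e') \<longrightarrow> e = e')"
proof -
  have small: "k = 0" if "2 * M dvd k" "\<bar>k\<bar> < 2 * M" for k :: int
    using that dvd_imp_le_int[of k "2 * M"] assms by auto
  consider "3 dvd M" | "\<not> 3 dvd M" "odd M" | "\<not> 3 dvd M" "even M"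
    by blast
  then show ?thesis
  proof cases
    case 1
    then have M3: "M \<ge> 3"
      using assms by (auto elim!: dvdE)
    \<comment> \<open>Write \<open>e\<close> as \<open>2 * j\<close> or \<open>2 * j + 1\<close>.
      When \<open>j\<close> grows by one, the row, column and symbol exponents change by -1, 3 and
      2, and as \<open>2 * j < M\<close> none of them repeats modulo \<open>2 * M\<close> within a
      parity class. Between the classes, rows are separated by size, columns modulo 3 and symbols
      modulo 2.\<close>
    define A d where "A e = (if even e then - (e div 2) else M - 1 - e div 2)"
      and "d e = e mod 2" for e :: int
    have ev: "A (2 * j) = - j" "d (2 * j) = 0" and od: "A (2 * j + 1) = M - 1 - j" "d (2 * j + 1) = 1" for j
      by (simp_all add: A_def d_def)
    have mixed: False
      if j: "0 \<le> j" "2 * j < M" "0 \<le> j'" "2 * j' + 1 < M" and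
        "2 * M dvd (- j) - (M - 2 - j') \<or> 2 * M dvd 3 * j - (3 * j' + 1 + M) \<or>
         2 * M dvd 2 * j - (2 * j' - 1 + 2 * M)" for j j'
      using that(5)
    proof (elim disjE)
      assume "2 * M dvd (- j) - (M - 2 - j')"
      then have "- j - (M - 2 - j') = 0"
        using j M3 by (intro small) auto
      then show False
        using j M3 by linarith
    next
      assume "2 * M dvd 3 * j - (3 * j' + 1 + M)"
      then have "3 dvd 3 * j - (3 * j' + 1 + M)"
        using 1 by (meson dvd_mult dvd_trans)
      then show False
        using 1 by presburger
    next
      assume "2 * M dvd 2 * j - (2 * j' - 1 + 2 * M)"
      then have "2 dvd 2 * j - (2 * j' - 1 + 2 * M)"
        using dvd_mult_left by blast
      then show False
        by presburger
    qed
    show ?thesis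
    proof (rule exI[of _ A], rule exI[of _ d], intro conjI ballI impI)
      fix e assume e: "e \<in> {0..<M}"
      show "d e \<in> {0, 1}"
        by (auto simp: d_def)
      assume "d e = 1"
      then obtain j where "e = 2 * j + 1"
        by (metis d_def mod_mult_div_eq add.commute)
      with e od show "\<not> M dvd A e"
        by (auto dest!: zdvd_imp_le)
    next
      fix e e' assume e: "e \<in> {0..<M}" "e' \<in> {0..<M}" and
        *: "2 * M dvd (A e - d e) - (A e' - d e') \<or> 2 * M dvd (A e + 2 * e) - (A e' + 2 * e') \<or>
         2 * M dvd (2 * A e + 2 * e - d e) - (2 * A e' + 2 * e' - d e')"
      obtain j j' where "e = 2 * j \<or> e = 2 * j + 1" "e' = 2 * j' \<or> e' = 2 * j' + 1"
        by (metis evenE oddE)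
      then consider "e = 2 * j" "e' = 2 * j'" | "e = 2 * j + 1" "e' = 2 * j' + 1"
        | "e = 2 * j" "e' = 2 * j' + 1" | "e = 2 * j + 1" "e' = 2 * j'"
        by blast
      then show "e = e'"
      proof cases
        case 1
        then have "2 * M dvd j' - j \<or> 2 * M dvd 3 * (j - j') \<or> 2 * M dvd 2 * (j - j')"
          using * unfolding 1 ev by (simp add: algebra_simps)
        moreover have "\<bar>3 * (j - j')\<bar> < 2 * M" "\<bar>j' - j\<bar> < 2 * M" "\<bar>2 * (j - j')\<bar> < 2 * M"
          using e 1 by auto
        ultimately have "j = j'"
          using small[of "3 * (j - j')"] small[of "j' - j"] small[of "2 * (j - j')"] by auto
        then show ?thesis
          using 1 by simp
      next
        case 2
        then have "2 * M dvd j' - j \<or> 2 * M dvd 3 * (j - j') \<or> 2 * M dvd 2 * (j - j')"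
          using * unfolding 2 od by (simp add: algebra_simps)
        moreover have "\<bar>3 * (j - j')\<bar> < 2 * M" "\<bar>j' - j\<bar> < 2 * M" "\<bar>2 * (j - j')\<bar> < 2 * M"
          using e 2 by auto
        ultimately have "j = j'"
          using small[of "3 * (j - j')"] small[of "j' - j"] small[of "2 * (j - j')"] by auto
        then show ?thesis
          using 2 by simp
      next
        case 3
        have False
        proof (rule mixed[of j j'])
          show "2 * M dvd - j - (M - 2 - j') \<or> 2 * M dvd 3 * j - (3 * j' + 1 + M) \<or>
            2 * M dvd 2 * j - (2 * j' - 1 + 2 * M)"
            using * unfolding 3 ev od by (simp add: algebra_simps)
        qed (use e 3 in auto)
        then show ?thesis ..
      next
        case 4
        have False
        proof (rule mixed[of j' j])
          show "2 * M dvd - j' - (M - 2 - j) \<or> 2 * M dvd 3 * j' - (3 * j + 1 + M) \<or>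
            2 * M dvd 2 * j' - (2 * j - 1 + 2 * M)"
            using * unfolding 4 ev od
            by (subst (1 2 3) dvd_minus_iff[symmetric]) (simp add: algebra_simps)
        qed (use e 4 in auto)
        then show ?thesis ..
      qed
    qed
  next
    case 2
    have c3: "coprime 3 (2 * M)"
      using 2 by (intro prime_imp_coprime) (auto simp: prime_dvd_mult_iff)
    \<comment> \<open>The three differences are now \<open>e - e'\<close> times 1, 3 and 4. The
      factor 3 is invertible modulo \<open>2 * M\<close>, and 4 is invertible modulo the odd number
      \<open>M\<close>.\<close>
    show ?thesis
    proof (rule exI[of _ "\<lambda>e. e"], rule exI[of _ "\<lambda>_. 0"], intro conjI ballI impI)
      fix e e' assume e: "e \<in> {0..<M}" "e' \<in> {0..<M}"
        "2 * M dvd e - 0 - (e' - 0) \<or> 2 * M dvd e + 2 * e - (e' + 2 * e') \<or>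
         2 * M dvd 2 * e + 2 * e - 0 - (2 * e' + 2 * e' - 0)"
      then consider "2 * M dvd e - e'" | "2 * M dvd 3 * (e - e')" | "2 * M dvd 2 * (2 * (e - e'))"
        by (auto simp: algebra_simps)
      then have "M dvd e - e'"
      proof cases
        case 2
        then show ?thesis
          using c3 by (metis coprime_commute coprime_dvd_mult_right_iff dvd_mult_right)
      next
        case 3
        then show ?thesis
          using \<open>odd M\<close> by (metis coprime_dvd_mult_right_iff coprime_right_2_iff_odd
              dvd_times_left_cancel_iff zero_neq_numeral)
      qed (auto dest: dvd_mult_right)
      then show "e = e'"
        using e(1,2) dvd_imp_le_int[of "e - e'" M] assms by (simp, linarith)
    qed auto
  next
    case 3
    then obtain h where h: "M = 2 * h"
      by blast
    have c3: "coprime (2 * M) 3"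
      using 3 by (subst coprime_commute, intro prime_imp_coprime) (auto simp: prime_dvd_mult_iff)
    \<comment> \<open>For even \<open>M\<close> the symbol exponent \<open>4 * e\<close> alone would
      repeat modulo \<open>2 * M\<close> after \<open>h\<close> steps; subtracting 1 on the first
      half separates the halves modulo 4. Taking \<open>e + 1\<close> for \<open>A\<close> avoids
      multiples of \<open>M\<close> on that half.\<close>
    define d where "d e = (if e < h then 1 else 0 :: int)" for e
    show ?thesis
    proof (rule exI[of _ "\<lambda>e. e + 1"], rule exI[of _ d], intro conjI ballI impI)
      fix e assume "e \<in> {0..<M}" "d e = 1"
      then show "\<not> M dvd e + 1"
        using h by (auto simp: d_def split: if_splits dest!: zdvd_imp_le)
    next
      fix e e' assume e: "e \<in> {0..<M}" "e' \<in> {0..<M}" and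
        *: "2 * M dvd e + 1 - d e - (e' + 1 - d e') \<or> 2 * M dvd e + 1 + 2 * e - (e' + 1 + 2 * e') \<or>
         2 * M dvd 2 * (e + 1) + 2 * e - d e - (2 * (e' + 1) + 2 * e' - d e')"
      then consider "2 * M dvd e - e' - d e + d e'" | "2 * M dvd 3 * (e - e')"
        | "2 * M dvd 4 * (e - e') - (d e - d e')"
        by (auto simp: algebra_simps)
      then show "e = e'"
      proof cases
        case 1
        then have "e - e' - d e + d e' = 0"
          using e by (intro small) (auto simp: d_def)
        then show ?thesis
          by (auto simp: d_def split: if_splits)
      next
        case 2
        then have "2 * M dvd e - e'"
          using c3 coprime_dvd_mult_right_iff by blast
        then have "e - e' = 0"
          using e by (intro small) auto
        then show ?thesis
          by simp
      next
        case 3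
        have "4 dvd 2 * M"
          using h by simp
        with 3 have "4 dvd 4 * (e - e') - (d e - d e')"
          by (rule dvd_trans[rotated])
        then have d: "d e = d e'"
          by (auto simp: d_def split: if_splits) presburger+
        with 3 h have "4 * h dvd 4 * (e - e')"
          by simp
        then have "h dvd e - e'"
          by (metis dvd_times_left_cancel_iff zero_neq_numeral)
        moreover have "\<bar>e - e'\<bar> < h"
          using d e h by (auto simp: d_def split: if_splits)
        ultimately show ?thesis
          using dvd_imp_le_int[of "e - e'" h] by auto
      qed
    qed (auto simp: d_def)
  qed
qed

section \<open>Cyclic groups and Sylow 2-subgroups\<close>

context comm_group
begin

lemma subgroup_comm_group:
  assumes "subgroup H G"
  shows "comm_group (G\<lparr>carrier := H\<rparr>)"
  using subgroup.subgroup_is_group[OF assms is_group] subgroup.mem_carrier[OF assms]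
  by (intro group.group_comm_groupI) (auto intro: m_comm)

text \<open>Take \<open>g\<close> with a cyclic subgroup of maximal size and an element outside it
  whose \<open>p\<close>-th power is inside. Either a translate of it by a power of \<open>g\<close>
  generates a larger cyclic subgroup, or it is a power of \<open>g\<close> times an element killed
  by \<open>p\<close>, and the hypothesis makes that element a power of \<open>g\<close> as
  well.\<close>

lemma cyclic_if_unique_prime_subgroups:
  assumes fin: "finite (carrier G)"
    and uniq: "\<And>p x y. Factorial_Ring.prime (p::nat) \<Longrightarrow> x \<in> carrier G \<Longrightarrow> y \<in> carrier G \<Longrightarrow>
      x [^] p = \<one> \<Longrightarrow> y [^] p = \<one> \<Longrightarrow> x \<noteq> \<one> \<Longrightarrow> \<exists>i::int. y = x [^] i"
  shows "\<exists>g\<in>carrier G. carrier G = range (\<lambda>i::int. g [^] i)"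
proof -
  define S where "S g = range (\<lambda>i::int. g [^] i)" for g
  have SG: "S x \<subseteq> carrier G" if "x \<in> carrier G" for x
    using that by (auto simp: S_def)
  have Sm: "u \<otimes> v \<in> S x" if "u \<in> S x" "v \<in> S x" "x \<in> carrier G" for u v x
    using that by (auto simp: S_def int_pow_mult[symmetric])
  have SS: "S u \<subseteq> S x" if "u \<in> S x" "x \<in> carrier G" for u x
    using that by (auto simp: S_def int_pow_pow)
  have self: "x \<in> S x" if "x \<in> carrier G" for x
    unfolding S_def using that by (metis int_pow_1 rangeI)
  have "Max ((\<lambda>x. card (S x)) ` carrier G) \<in> (\<lambda>x. card (S x)) ` carrier G"
    using fin by (intro Max_in) auto
  then obtain g where g: "g \<in> carrier G" "card (S g) = Max ((\<lambda>x. card (S x)) ` carrier G)"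
    by force
  have g_max: "card (S x) \<le> card (S g)" if "x \<in> carrier G" for x
    using that fin g(2) by simp
  have ext: "x \<in> S g" if "g \<in> S x" "x \<in> carrier G" for x
  proof -
    have "S g = S x"
      using SS[OF that] g_max[OF that(2)] finite_subset[OF SG[OF that(2)] fin] by (intro card_seteq)
    then show ?thesis
      using self that by simp
  qed
  have "y0 \<in> S g" if y0: "y0 \<in> carrier G" for y0
  proof (rule ccontr)
    assume neg: "y0 \<notin> S g"
    have one: "\<one> \<in> S g"
      unfolding S_def by (metis int_pow_0 rangeI)
    have "ord y0 \<ge> 1 \<and> y0 [^] ord y0 \<in> S g"
      using y0 fin ord_ge_1 one by simp
    then have ex: "\<exists>k. k \<ge> 1 \<and> y0 [^] (k::nat) \<in> S g"
      by blast
    \<comment> \<open>Dividing the least exponent that leads into \<open>S g\<close> by a prime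
      factor \<open>p\<close> gives an element \<open>y\<close> outside \<open>S g\<close> whose
      \<open>p\<close>-th power is inside.\<close>
    define k where "k = (LEAST k. k \<ge> 1 \<and> y0 [^] (k::nat) \<in> S g)"
    have k: "k \<ge> 1" "y0 [^] k \<in> S g"
      using LeastI_ex[OF ex] by (auto simp: k_def)
    have "k \<noteq> 1"
      using k neg y0 by auto
    then obtain p where p: "Factorial_Ring.prime p" "p dvd k"
      using prime_factor_nat by blast
    then obtain k' where k': "k = k' * p"
      by (metis dvd_def mult.commute)
    define y where "y = y0 [^] k'"
    have y: "y \<in> carrier G" "y [^] p \<in> S g"
      using y0 k k' by (simp_all add: y_def nat_pow_pow)
    have "k' \<ge> 1" "k' < k"
      using k k' p prime_gt_1_nat[of p] by (auto simp: Suc_le_eq)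
    then have ynot: "y \<notin> S g"
      using not_less_Least[of k' "\<lambda>k. k \<ge> 1 \<and> y0 [^] (k::nat) \<in> S g"] by (auto simp: k_def y_def)
    from y obtain l :: int where l: "y [^] p = g [^] l"
      by (auto simp: S_def)
    define N where "N = int (ord g)"
    have N: "N > 0"
      using g fin ord_ge_1[of g] by (simp add: N_def)
    have pow_p: "(y \<otimes> g [^] t) [^] p = g [^] (l + int p * t)" for t :: int
    proof -
      have "(y \<otimes> g [^] t) [^] p = y [^] p \<otimes> (g [^] t) [^] p"
        using y g by (simp add: nat_pow_distrib)
      also have "(g [^] t) [^] p = g [^] (int p * t)"
        using g by (simp add: int_pow_int[symmetric] int_pow_pow mult.commute)
      finally show ?thesis
        using g l by (simp add: int_pow_mult)
    qed
    have notin: "y \<otimes> g [^] t \<notin> S g" for t :: int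
    proof
      assume "y \<otimes> g [^] t \<in> S g"
      then have "y \<otimes> g [^] t \<otimes> g [^] (- t) \<in> S g"
        by (rule Sm) (use g in \<open>auto simp: S_def\<close>)
      moreover have "y \<otimes> g [^] t \<otimes> g [^] (- t) = y"
        using y g by (simp add: m_assoc int_pow_neg)
      ultimately show False
        using ynot by simp
    qed
    show False
    proof (cases "int p dvd l \<and> int p dvd N")
      case False
      \<comment> \<open>With an exponent prime to \<open>N\<close>, the \<open>p\<close>-th power of
        \<open>y \<otimes> g [^] t\<close> generates \<open>S g\<close>; by the maximality of
        \<open>S g\<close> (fact \<open>ext\<close>) this element would itself lie in
        \<open>S g\<close>.\<close>
      then obtain t where "coprime (l + int p * t) N"
        using coprime_shift_exists[OF p(1) N] by blast
      then obtain u v where u: "u * (l + int p * t) + v * N = 1"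
        using bezout_int[of "l + int p * t" N] by auto
      have "((y \<otimes> g [^] t) [^] p) [^] u = g"
      proof -
        have "1 - (l + int p * t) * u = N * v"
          using u by (simp add: algebra_simps)
        then have dvd: "int (ord g) dvd 1 - (l + int p * t) * u"
          by (simp add: N_def)
        have "((y \<otimes> g [^] t) [^] p) [^] u = g [^] ((l + int p * t) * u)"
          using g by (simp add: pow_p int_pow_pow)
        also have "\<dots> = g [^] (1::int)"
          using dvd g by (simp only: int_pow_eq)
        finally show ?thesis
          using g by simp
      qed
      then have "g \<in> S (y \<otimes> g [^] t)"
        using y g by (auto simp: S_def int_pow_int[symmetric] int_pow_pow image_iff intro!: exI[of _ "int p * u"])
      then show False
        using ext[of "y \<otimes> g [^] t"] notin y g by simp
    next
      case True
      \<comment> \<open>Now \<open>g [^] N'\<close> has order \<open>p\<close> and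
        \<open>y \<otimes> g [^] (- l')\<close> is killed by \<open>p\<close>, so the uniqueness
        hypothesis compares the two.\<close>
      then obtain l' N' where l': "l = int p * l'" and N': "N = int p * N'"
        by (auto elim!: dvdE)
      have p0: "int p > 1"
        using prime_gt_1_nat[OF p(1)] by simp
      have N'0: "N' > 0" "N' < N"
        using N p0 unfolding N' by (simp_all add: zero_less_mult_iff)
      have "g [^] N' \<noteq> \<one>"
        using N'0 g zdvd_imp_le[of N N'] by (auto simp: int_pow_eq_id N_def)
      moreover have "(g [^] N') [^] p = \<one>"
        using g by (simp add: int_pow_int[symmetric] int_pow_pow int_pow_eq_id N_def[symmetric] N' mult.commute)
      moreover have "(y \<otimes> g [^] (- l')) [^] p = \<one>"
        using g unfolding pow_p l' by simp
      ultimately obtain i :: int where "y \<otimes> g [^] (- l') = (g [^] N') [^] i"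
        using uniq[OF p(1), of "g [^] N'" "y \<otimes> g [^] (- l')"] y g by auto
      then have "y \<otimes> g [^] (- l') \<in> S g"
        using g by (simp add: int_pow_pow S_def)
      then show False
        using notin by blast
    qed
  qed
  then have "carrier G = S g"
    using SG g by blast
  then show ?thesis
    using g unfolding S_def by blast
qed

text \<open>The preceding criterion for \<open>G Mod H\<close>, phrased with representatives so that
  its later use needs no cosets.\<close>

lemma cyclic_quotient_if_unique_prime_subgroups:
  assumes fin: "finite (carrier G)" and H: "subgroup H G"
    and uniq: "\<And>p x y. Factorial_Ring.prime (p::nat) \<Longrightarrow> x \<in> carrier G \<Longrightarrow> y \<in> carrier G \<Longrightarrow>
      x [^] p \<in> H \<Longrightarrow> y [^] p \<in> H \<Longrightarrow> x \<notin> H \<Longrightarrow> \<exists>i::int. \<exists>h\<in>H. y = h \<otimes> x [^] i"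
  shows "\<exists>g\<in>carrier G. \<forall>x\<in>carrier G. \<exists>i::int. \<exists>h\<in>H. x = h \<otimes> g [^] i"
proof -
  interpret H: normal H G
    using H by (rule subgroup_imp_normal)
  interpret Q: comm_group "G Mod H"
    using H by (rule abelian_FactGroup)
  have HG: "H \<subseteq> carrier G"
    by (rule H.subset)
  have in_H: "x \<in> H" if "H #> x = H" "x \<in> carrier G" for x
    using coset_join1[OF that H] .
  have join: "H #> x = H" if "x \<in> H" for x
    using H that coset_join2 H.mem_carrier by blast
  have "\<exists>g\<in>carrier (G Mod H). carrier (G Mod H) = range (\<lambda>i::int. g [^]\<^bsub>G Mod H\<^esub> i)"
  proof (rule Q.cyclic_if_unique_prime_subgroups)
    show "finite (carrier (G Mod H))"
      using fin by (simp add: carrier_FactGroup)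
  next
    fix p :: nat and u v
    assume p: "Factorial_Ring.prime p" and "u \<in> carrier (G Mod H)" "v \<in> carrier (G Mod H)"
      and uv: "u [^]\<^bsub>G Mod H\<^esub> p = \<one>\<^bsub>G Mod H\<^esub>" "v [^]\<^bsub>G Mod H\<^esub> p = \<one>\<^bsub>G Mod H\<^esub>"
        "u \<noteq> \<one>\<^bsub>G Mod H\<^esub>"
    then obtain x y where xy: "x \<in> carrier G" "u = H #> x" "y \<in> carrier G" "v = H #> y"
      by (auto simp: carrier_FactGroup)
    have "x [^] p \<in> H" "y [^] p \<in> H" "x \<notin> H"
      using uv xy by (auto simp: H.FactGroup_pow in_H join)
    then obtain i :: int and h where h: "h \<in> H" "y = h \<otimes> x [^] i"
      using uniq[OF p xy(1,3)] by blast
    have "v = H #> h #> x [^] i"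
      using xy h HG by (simp add: coset_mult_assoc H.mem_carrier)
    also have "\<dots> = u [^]\<^bsub>G Mod H\<^esub> i"
      using xy h by (simp add: join H.FactGroup_int_pow)
    finally show "\<exists>i::int. v = u [^]\<^bsub>G Mod H\<^esub> i" ..
  qed
  then obtain g where g: "g \<in> carrier G"
    and gen: "carrier (G Mod H) = range (\<lambda>i::int. (H #> g) [^]\<^bsub>G Mod H\<^esub> i)"
    by (auto simp: carrier_FactGroup)
  have "\<exists>i::int. \<exists>h\<in>H. x = h \<otimes> g [^] i" if x: "x \<in> carrier G" for x
  proof -
    have "H #> x \<in> carrier (G Mod H)"
      using x by (auto simp: carrier_FactGroup)
    then obtain i :: int where "H #> x = H #> g [^] i"
      using g by (auto simp: gen H.FactGroup_int_pow)
    then have "x \<in> H #> g [^] i"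
      using x H rcos_self by blast
    then show ?thesis
      by (auto simp: r_coset_def)
  qed
  then show ?thesis
    using g by blast
qed

text \<open>With a unique involution the cyclicity criterion applies to a Sylow 2-subgroup, where 2
  is the only prime order of an element. Conversely a Sylow 2-subgroup has odd index and so contains
  every involution, and a nontrivial cyclic 2-group has just one.\<close>

lemma unique_involution_iff_sylow:
  assumes fin: "finite (carrier G)"
  shows "(\<exists>!z. z \<in> carrier G \<and> z \<otimes> z = \<one> \<and> z \<noteq> \<one>) \<longleftrightarrow>
    (\<exists>P. sylow_subgroup 2 G P \<and> \<not> trivial_group (G\<lparr>carrier := P\<rparr>) \<and> cyclic_group (G\<lparr>carrier := P\<rparr>))"
    (is "?unique \<longleftrightarrow> ?sylow")
proof
  assume ?unique
  then obtain z where z: "z \<in> carrier G" "z \<otimes> z = \<one>" "z \<noteq> \<one>"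
    and uniq: "\<And>u. u \<in> carrier G \<Longrightarrow> u \<otimes> u = \<one> \<Longrightarrow> u \<noteq> \<one> \<Longrightarrow> u = z"
    by blast
  have ordz: "ord z = 2"
    using z ord_ge_1[OF fin z(1)] pow_eq_id[OF z(1), of 2] ord_eq_1[OF z(1)]
    by (auto simp: numeral_2_eq_2 dest!: dvd_imp_le)
  obtain P where P: "sylow_subgroup 2 G P"
    using sylow_subgroup_exists[OF fin two_is_prime_nat] by blast
  then have sub: "subgroup P G" and cardP: "card P = 2 ^ multiplicity 2 (order G)"
    by (auto simp: sylow_subgroup_def)
  have PG: "P \<subseteq> carrier G" and finP: "finite P"
    using subgroup.subset[OF sub] finite_subset[OF _ fin] by auto
  interpret P: comm_group "G\<lparr>carrier := P\<rparr>"
    using sub by (rule subgroup_comm_group)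
  have "2 dvd order G"
    using ord_dvd_group_order[OF z(1)] ordz by simp
  moreover have "order G \<noteq> 0"
    using fin order_gt_0_iff_finite by simp
  ultimately have "multiplicity 2 (order G) > 0"
    by (simp add: multiplicity_gt_zero_iff)
  then have "card P \<noteq> 1"
    by (simp add: cardP)
  then have "\<not> trivial_group (G\<lparr>carrier := P\<rparr>)"
    by (auto simp: trivial_group_def)
  moreover have "\<exists>g\<in>carrier (G\<lparr>carrier := P\<rparr>). carrier (G\<lparr>carrier := P\<rparr>) =
    range (\<lambda>i::int. g [^]\<^bsub>G\<lparr>carrier := P\<rparr>\<^esub> i)"
  proof (rule P.cyclic_if_unique_prime_subgroups)
    show "finite (carrier (G\<lparr>carrier := P\<rparr>))"
      using finP by simp
  next
    fix p :: nat and x y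
    assume p: "Factorial_Ring.prime p" and "x \<in> carrier (G\<lparr>carrier := P\<rparr>)"
      "y \<in> carrier (G\<lparr>carrier := P\<rparr>)" "x [^]\<^bsub>G\<lparr>carrier := P\<rparr>\<^esub> p = \<one>\<^bsub>G\<lparr>carrier := P\<rparr>\<^esub>"
      "y [^]\<^bsub>G\<lparr>carrier := P\<rparr>\<^esub> p = \<one>\<^bsub>G\<lparr>carrier := P\<rparr>\<^esub>" "x \<noteq> \<one>\<^bsub>G\<lparr>carrier := P\<rparr>\<^esub>"
    then have xP: "x \<in> P" "y \<in> P" and x: "x [^] p = \<one>" "y [^] p = \<one>" "x \<noteq> \<one>"
      by (simp_all add: nat_pow_consistent[symmetric])
    have xG: "x \<in> carrier G" "y \<in> carrier G"
      using xP PG by auto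
    have "ord x dvd p"
      using x xG pow_eq_id by blast
    moreover have "ord x \<noteq> 1"
      using x xG ord_eq_1 by simp
    ultimately have "ord x = p"
      using p by (metis prime_nat_iff)
    moreover have "ord x dvd card P"
      using P.ord_dvd_group_order[of x] xP P.pow_eq_id[of x "card P"] pow_eq_id[of x "card P"] xG
        nat_pow_consistent[of x "card P" P] P.pow_order_eq_1[of x]
      by (simp add: order_def)
    ultimately have "p = 2"
      using p cardP prime_dvd_power[of p 2] primes_dvd_imp_eq[of p 2] by auto
    then have "x = z" "y = \<one> \<or> y = z"
      using x xG uniq by (auto simp: numeral_2_eq_2)
    then have "y = x [^] (0::int) \<or> y = x [^] (1::int)"
      using xG by auto
    then show "\<exists>i::int. y = x [^]\<^bsub>G\<lparr>carrier := P\<rparr>\<^esub> i"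
      using int_pow_consistent[OF sub xP(1)] by metis
  qed
  ultimately show ?sylow
    using P P.cyclic_group by auto
next
  assume ?sylow
  then obtain P where sub: "subgroup P G" and cardP: "card P = 2 ^ multiplicity 2 (order G)"
    and nontriv: "\<not> trivial_group (G\<lparr>carrier := P\<rparr>)" and cyc: "cyclic_group (G\<lparr>carrier := P\<rparr>)"
    by (auto simp: sylow_subgroup_def)
  have PG: "P \<subseteq> carrier G" and finP: "finite P"
    using subgroup.subset[OF sub] finite_subset[OF _ fin] by auto
  interpret Pn: normal P G
    using sub by (rule subgroup_imp_normal)
  interpret P: comm_group "G\<lparr>carrier := P\<rparr>"
    using sub by (rule subgroup_comm_group)
  define k where "k = multiplicity 2 (order G)"
  obtain d where dP: "d \<in> P" "P = range (\<lambda>i::int. d [^]\<^bsub>G\<lparr>carrier := P\<rparr>\<^esub> i)"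
    using cyc unfolding P.cyclic_group by auto
  have d: "d \<in> P" "P = range (\<lambda>i::int. d [^] i)"
    using dP int_pow_consistent[OF sub dP(1)] by simp_all
  have dG: "d \<in> carrier G"
    using d PG by auto
  have "k \<noteq> 0"
  proof
    assume "k = 0"
    then have "card P = 1"
      by (simp add: cardP k_def)
    then have "P = {\<one>}"
      using Pn.one_closed by (metis card_1_singletonE singletonD)
    then show False
      using nontriv P.is_group by (simp add: trivial_group_def)
  qed
  then obtain k' where k': "k = Suc k'"
    using not0_implies_Suc by blast
  have ordd: "ord d = 2 ^ k"
  proof -
    have "P = (\<lambda>i::int. d [^] i) ` {0..<int (ord d)}"
    proof
      show "P \<subseteq> (\<lambda>i::int. d [^] i) ` {0..<int (ord d)}"
      proof
        fix x assume "x \<in> P"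
        then obtain i :: int where "x = d [^] i"
          using d by auto
        moreover have "d [^] i = d [^] (i mod int (ord d))"
          using dG by (simp add: int_pow_eq mod_eq_dvd_iff[symmetric])
        ultimately show "x \<in> (\<lambda>i::int. d [^] i) ` {0..<int (ord d)}"
          using ord_ge_1[OF fin dG] by (intro image_eqI[of _ _ "i mod int (ord d)"]) auto
      qed
    qed (use d in auto)
    moreover have "inj_on (\<lambda>i::int. d [^] i) {0..<int (ord d)}"
    proof (rule inj_onI)
      fix i j assume *: "i \<in> {0..<int (ord d)}" "j \<in> {0..<int (ord d)}" "d [^] i = d [^] j"
      then have "int (ord d) dvd j - i"
        using dG int_pow_eq by simp
      then show "i = j"
        using * int_dvd_diff_imp_eq[of "int (ord d)" j i] by auto
    qed
    ultimately have "card P = ord d"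
      by (metis card_image card_atLeastLessThan_int nat_int diff_zero)
    then show ?thesis
      by (simp add: cardP k_def)
  qed
  define z where "z = d [^] (2 ^ k' :: int)"
  have z: "z \<in> carrier G" "z \<otimes> z = \<one>" "z \<noteq> \<one>"
  proof -
    have "z \<otimes> z = d [^] (2 ^ k' + 2 ^ k' :: int)"
      using dG by (simp only: z_def int_pow_mult)
    then show "z \<otimes> z = \<one>"
      using dG by (simp add: int_pow_eq_id ordd k')
    have "\<not> (2::int) ^ k dvd 2 ^ k'"
      using zdvd_imp_le[of "2 ^ k" "2 ^ k'"] by (simp add: k')
    then show "z \<noteq> \<one>"
      using dG by (simp add: z_def int_pow_eq_id ordd)
  qed (use dG in \<open>simp add: z_def\<close>)
  have "u = z" if u: "u \<in> carrier G" "u \<otimes> u = \<one>" "u \<noteq> \<one>" for u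
  proof -
    define m where "m = card (rcosets P)"
    have "order G = card P * m"
      using lagrange[OF sub] by (simp add: m_def mult.commute)
    then have oG: "order G = 2 ^ k * m"
      by (simp add: cardP k_def)
    have "order G \<noteq> 0"
      using fin order_gt_0_iff_finite by simp
    moreover have "order G div 2 ^ k = m"
      by (simp add: oG)
    ultimately have "odd m"
      using multiplicity_decompose[of "order G" 2] unfolding k_def by simp
    have ordQ: "order (G Mod P) = m"
      by (simp add: order_def FactGroup_def m_def)
    \<comment> \<open>Raising to the power of the odd index \<open>m\<close> fixes the involution
      \<open>u\<close> and also carries it into \<open>P\<close>.\<close>
    have "(P #> u) [^]\<^bsub>G Mod P\<^esub> order (G Mod P) = \<one>\<^bsub>G Mod P\<^esub>"
      using u by (intro group.pow_order_eq_1 Pn.factorgroup_is_group) (auto simp: carrier_FactGroup)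
    then have "P #> u [^] m = P"
      by (simp only: ordQ Pn.FactGroup_pow[OF u(1)] one_FactGroup)
    then have "u [^] m \<in> P"
      using coset_join1[OF _ _ sub] u by simp
    moreover have "u [^] m = u"
    proof -
      obtain c where "m = Suc (2 * c)"
        using \<open>odd m\<close> by (auto elim: oddE)
      then have "u [^] m = (u [^] (2::nat)) [^] c \<otimes> u"
        using u by (simp add: nat_pow_pow)
      then show ?thesis
        using u by (simp add: numeral_2_eq_2)
    qed
    ultimately obtain i :: int where i: "u = d [^] i"
      using d by auto
    then have "int (ord d) dvd i + i"
      using u dG by (simp add: int_pow_mult[symmetric] int_pow_eq_id)
    then have "2 * 2 ^ k' dvd 2 * i"
      by (simp add: ordd k')
    then obtain j where j: "i = 2 ^ k' * j"
      by (auto elim: dvdE)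
    have "odd j"
    proof
      assume "even j"
      then have "int (ord d) dvd i"
        by (auto simp: j ordd k')
      then show False
        using u i dG by (simp add: int_pow_eq_id)
    qed
    then have "int (ord d) dvd 2 ^ k' - i"
      by (auto simp: j ordd k' algebra_simps elim!: oddE)
    then show "u = z"
      using dG by (simp add: i z_def int_pow_eq)
  qed
  then show ?unique
    using z by blast
qed

end

section \<open>Subgroups of odd order\<close>

context comm_group
begin

text \<open>The order of \<open>x \<otimes> inv y\<close> divides both 2 and the odd number
  \<open>card H\<close>.\<close>

lemma odd_subgroup_square_cancel:
  assumes H: "subgroup H G" "odd (card H)" and xy: "x \<in> H" "y \<in> H" "x \<otimes> x = y \<otimes> y"
  shows "x = y"
proof -
  interpret H: subgroup H G by fact
  interpret HG: group "G\<lparr>carrier := H\<rparr>"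
    using H(1) is_group by (rule subgroup.subgroup_is_group)
  let ?u = "x \<otimes> inv y"
  have c: "x \<in> carrier G" "y \<in> carrier G"
    using xy by (auto simp: H.mem_carrier)
  have u: "?u \<in> H"
    using xy by simp
  have "?u \<otimes> ?u = (x \<otimes> x) \<otimes> inv (y \<otimes> y)"
    using c by (simp add: inv_mult m_ac)
  also have "\<dots> = \<one>"
    using c xy by simp
  finally have "?u [^] (2::nat) = \<one>"
    using c by (simp add: numeral_2_eq_2)
  moreover have "?u [^] card H = \<one>"
    using HG.pow_order_eq_1[of ?u] u by (simp add: order_def nat_pow_consistent[symmetric])
  ultimately have "ord ?u dvd 2" "ord ?u dvd card H"
    using c pow_eq_id[of ?u] by simp_all
  then have "ord ?u = 1"
    using H(2) coprime_common_divisor_nat[of 2 "card H" "ord ?u"] by simp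
  then have "?u = \<one>"
    using c by (simp add: ord_eq_1[symmetric])
  then show ?thesis
    using c by (metis inv_equality inv_inv inv_closed)
qed

text \<open>The number \<open>b\<close> is the order of the coset of \<open>x\<close> in
  \<open>G Mod H\<close>.\<close>

lemma subgroup_period:
  assumes fin: "finite (carrier G)" and H: "subgroup H G" and x: "x \<in> carrier G"
  obtains b :: nat where "b > 0" "\<And>i::int. x [^] i \<in> H \<longleftrightarrow> int b dvd i"
proof -
  interpret H: normal H G
    using H by (rule subgroup_imp_normal)
  interpret Q: comm_group "G Mod H"
    using H by (rule abelian_FactGroup)
  have Hx: "H #> x \<in> carrier (G Mod H)"
    using x by (auto simp: carrier_FactGroup)
  have "x [^] i \<in> H \<longleftrightarrow> int (Q.ord (H #> x)) dvd i" for i :: int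
  proof -
    have "x [^] i \<in> H \<longleftrightarrow> H #> x [^] i = H"
      using x H coset_join1[of H "x [^] i"] coset_join2[of "x [^] i" H] by auto
    also have "\<dots> \<longleftrightarrow> (H #> x) [^]\<^bsub>G Mod H\<^esub> i = \<one>\<^bsub>G Mod H\<^esub>"
      using x by (simp add: H.FactGroup_int_pow)
    also have "\<dots> \<longleftrightarrow> int (Q.ord (H #> x)) dvd i"
      using Hx by (rule Q.int_pow_eq_id)
    finally show ?thesis .
  qed
  moreover have "Q.ord (H #> x) > 0"
    using Q.ord_ge_1[OF _ Hx] fin by (simp add: carrier_FactGroup)
  ultimately show thesis
    using that by blast
qed

section \<open>Adjoining one element: the subgroup generated by \<open>H\<close> and
  \<open>x\<close>\<close>

definition adjoin :: "'a set \<Rightarrow> 'a \<Rightarrow> 'a set" where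
  "adjoin H x = {h \<otimes> x [^] (i::int) | h i. h \<in> H}"

lemma adjoin_subgroup:
  assumes H: "subgroup H G" and x: "x \<in> carrier G"
  shows "subgroup (adjoin H x) G"
proof -
  interpret H: subgroup H G by fact
  show ?thesis
  proof
    show "adjoin H x \<subseteq> carrier G"
      using x by (auto simp: adjoin_def)
    have "\<one> = \<one> \<otimes> x [^] (0::int)"
      by simp
    then show "\<one> \<in> adjoin H x"
      unfolding adjoin_def using H.one_closed by blast
  next
    fix u v assume "u \<in> adjoin H x" "v \<in> adjoin H x"
    then obtain h i k j where *: "h \<in> H" "u = h \<otimes> x [^] (i::int)" "k \<in> H" "v = k \<otimes> x [^] (j::int)"
      unfolding adjoin_def by blast
    then have "u \<otimes> v = (h \<otimes> k) \<otimes> x [^] (i + j)"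
      using x by (simp add: int_pow_mult m_ac)
    then show "u \<otimes> v \<in> adjoin H x"
      unfolding adjoin_def using * H.m_closed by blast
  next
    fix u assume "u \<in> adjoin H x"
    then obtain h i where *: "h \<in> H" "u = h \<otimes> x [^] (i::int)"
      unfolding adjoin_def by blast
    then have "inv u = inv h \<otimes> x [^] (- i)"
      using x by (simp add: int_pow_neg inv_mult)
    then show "inv u \<in> adjoin H x"
      unfolding adjoin_def using * H.m_inv_closed by blast
  qed
qed

lemma adjoin_superset:
  assumes "subgroup H G" "x \<in> carrier G"
  shows "H \<subseteq> adjoin H x" "x \<in> adjoin H x"
proof -
  interpret H: subgroup H G by fact
  show "H \<subseteq> adjoin H x"
  proof
    fix h assume "h \<in> H"
    then have "h = h \<otimes> x [^] (0::int)"
      by simp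
    then show "h \<in> adjoin H x"
      unfolding adjoin_def using \<open>h \<in> H\<close> by blast
  qed
  have "x = \<one> \<otimes> x [^] (1::int)"
    using assms by simp
  then show "x \<in> adjoin H x"
    unfolding adjoin_def using H.one_closed by blast
qed

lemma mult_int_pow_eq_imp_mem:
  assumes "subgroup H G" "x \<in> carrier G" "h \<in> H" "k \<in> H" "h \<otimes> x [^] i = k \<otimes> x [^] (j::int)"
  shows "x [^] (i - j) \<in> H"
proof -
  interpret H: subgroup H G by fact
  have "x [^] (i - j) = inv h \<otimes> (h \<otimes> x [^] i) \<otimes> inv (x [^] j)"
    using assms(2,3) by (simp add: int_pow_diff m_assoc[symmetric])
  also have "\<dots> = inv h \<otimes> k"
    unfolding assms(5) using assms(2-4) by (simp add: m_assoc)
  finally show ?thesis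
    using assms by simp
qed

text \<open>Reducing exponents modulo \<open>b\<close>, with the multiples of \<open>b\<close>
  absorbed into \<open>H\<close>, gives every element a unique form
  \<open>h \<otimes> x [^] i\<close> with \<open>i\<close> in \<open>{0..<int b}\<close>.\<close>

lemma adjoin_card:
  assumes fin: "finite (carrier G)" and H: "subgroup H G" and x: "x \<in> carrier G"
    and b: "b > 0" "\<And>i::int. x [^] i \<in> H \<longleftrightarrow> int b dvd i"
  shows "card (adjoin H x) = b * card H"
proof -
  interpret H: subgroup H G by fact
  have "bij_betw (\<lambda>(h, i). h \<otimes> x [^] i) (H \<times> {0..<int b}) (adjoin H x)"
  proof (rule bij_betwI')
    fix u v assume "u \<in> H \<times> {0..<int b}" "v \<in> H \<times> {0..<int b}"
    then obtain h i k j where *: "u = (h, i)" "v = (k, j)" "h \<in> H" "k \<in> H"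
      "i \<in> {0..<int b}" "j \<in> {0..<int b}"
      by blast
    show "((case u of (h, i) \<Rightarrow> h \<otimes> x [^] i) = (case v of (h, i) \<Rightarrow> h \<otimes> x [^] i)) = (u = v)"
    proof
      assume "(case u of (h, i) \<Rightarrow> h \<otimes> x [^] i) = (case v of (h, i) \<Rightarrow> h \<otimes> x [^] i)"
      then have eq: "h \<otimes> x [^] i = k \<otimes> x [^] j"
        using * by simp
      then have "int b dvd i - j"
        using mult_int_pow_eq_imp_mem[OF H x *(3,4)] b by simp
      then have "i = j"
        using *(5,6) int_dvd_diff_imp_eq by blast
      then show "u = v"
        using eq * x by (simp add: H.mem_carrier)
    qed simp
  next
    fix u assume "u \<in> H \<times> {0..<int b}"
    then show "(case u of (h, i) \<Rightarrow> h \<otimes> x [^] i) \<in> adjoin H x"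
      by (auto simp: adjoin_def)
  next
    fix u assume "u \<in> adjoin H x"
    then obtain h i where *: "h \<in> H" "u = h \<otimes> x [^] (i::int)"
      unfolding adjoin_def by blast
    have "x [^] i = x [^] (int b * (i div int b)) \<otimes> x [^] (i mod int b)"
      using x by (simp add: int_pow_mult[symmetric])
    then have "u = (h \<otimes> x [^] (int b * (i div int b))) \<otimes> x [^] (i mod int b)"
      using * x by (simp add: m_assoc)
    moreover have "h \<otimes> x [^] (int b * (i div int b)) \<in> H"
      using * b by simp
    ultimately show "\<exists>v\<in>H \<times> {0..<int b}. u = (case v of (h, i) \<Rightarrow> h \<otimes> x [^] i)"
      using b(1) by (intro bexI[of _ "(h \<otimes> x [^] (int b * (i div int b)), i mod int b)"]) auto
  qed
  then have "card (H \<times> {0..<int b}) = card (adjoin H x)"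
    by (rule bij_betw_same_card)
  then show ?thesis
    by (simp add: card_cartesian_product mult.commute)
qed

text \<open>Takes the place of an induction along chains of subgroups: what can be adjoined to a
  maximal \<open>H\<close> without losing \<open>P\<close> already lies in \<open>H\<close>.\<close>

lemma maximal_subgroup_exists:
  assumes fin: "finite (carrier G)" and "subgroup H0 G" "P H0"
  obtains H where "subgroup H G" "P H" "\<And>K. subgroup K G \<Longrightarrow> P K \<Longrightarrow> H \<subseteq> K \<Longrightarrow> K = H"
proof -
  have "finite {H. subgroup H G \<and> P H}"
    by (rule finite_subset[of _ "Pow (carrier G)"]) (auto simp: fin dest: subgroup.subset)
  then have "\<exists>H\<in>{H. subgroup H G \<and> P H}. \<forall>K\<in>{H. subgroup H G \<and> P H}. H \<subseteq> K \<longrightarrow> H = K"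
    using assms(2,3) by (intro finite_has_maximal) auto
  then show thesis
    using that by blast
qed

text \<open>Known as a harmonious sequence of \<open>H\<close>. Indexing by all integers with period
  \<open>card H\<close> turns the product across the end of the list into an ordinary case.\<close>

definition hamiltonian_sequence :: "'a set \<Rightarrow> (int \<Rightarrow> 'a) \<Rightarrow> bool" where
  "hamiltonian_sequence H r \<longleftrightarrow> (\<forall>t. r t \<in> H \<and> r (t + int (card H)) = r t) \<and>
     (\<forall>s t. r s = r t \<longrightarrow> int (card H) dvd s - t) \<and>
     (\<forall>s t. r s \<otimes> r (s + 1) = r t \<otimes> r (t + 1) \<longrightarrow> int (card H) dvd s - t)"

text \<open>The new sequence runs through the \<open>b\<close> cosets while \<open>r\<close> rests,
  and \<open>r\<close> moves on when the exponent returns to 0. Inside a run the consecutive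
  products are squares of \<open>r\<close> with exponent \<open>2 * i + 1\<close>; at the carry they
  are consecutive products of \<open>r\<close> with exponent \<open>b - 1\<close>. Since
  \<open>b\<close> and \<open>card H\<close> are odd, nothing repeats.\<close>

lemma hamiltonian_sequence_adjoin:
  assumes fin: "finite (carrier G)" and H: "subgroup H G" "odd (card H)"
    and r: "hamiltonian_sequence H r" and x: "x \<in> carrier G"
    and b: "odd b" "\<And>i::int. x [^] i \<in> H \<longleftrightarrow> int b dvd i"
  shows "hamiltonian_sequence (adjoin H x) (\<lambda>t. r (t div int b) \<otimes> x [^] (t mod int b))"
proof -
  interpret H: subgroup H G by fact
  have b0: "b > 0"
    using b(1) by (rule odd_pos)
  have rH [simp]: "r t \<in> H" and rG [simp]: "r t \<in> carrier G" for t
    using r by (auto simp: hamiltonian_sequence_def)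
  have per: "r (t + int (card H)) = r t" for t
    using r by (simp add: hamiltonian_sequence_def)
  have inj: "int (card H) dvd s - t" if "r s = r t" for s t
    using r that by (simp add: hamiltonian_sequence_def)
  have inj2: "int (card H) dvd s - t" if "r s \<otimes> r (s + 1) = r t \<otimes> r (t + 1)" for s t
    using r that by (simp add: hamiltonian_sequence_def)
  have lift: "int (b * card H) dvd s - t"
    if "s mod int b = t mod int b" "int (card H) dvd s div int b - t div int b" for s t
  proof -
    have "s - t = int b * (s div int b - t div int b)"
      using that(1) by (metis add_diff_cancel_right mult_div_mod_eq right_diff_distrib')
    then show ?thesis
      using that(2) by simp
  qed
  define q where "q t = r (t div int b) \<otimes> x [^] (t mod int b)" for t
  define c where "c t = (if t mod int b = int b - 1 then r (t div int b) \<otimes> r (t div int b + 1)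
    else r (t div int b) \<otimes> r (t div int b))" for t
  define e where "e t = (if t mod int b = int b - 1 then int b - 1 else 2 * (t mod int b) + 1)" for t
  have cH [simp]: "c t \<in> H" "c t \<in> carrier G" for t
    by (simp_all add: c_def)
  have qq: "q t \<otimes> q (t + 1) = c t \<otimes> x [^] e t" for t
  proof (cases "t mod int b = int b - 1")
    case True
    then have "(t + 1) mod int b = 0" "(t + 1) div int b = t div int b + 1"
      using int_add_carry[of "int b" t] b0 by simp_all
    then show ?thesis
      using True x by (simp add: q_def c_def e_def m_ac)
  next
    case False
    moreover have "t mod int b < int b"
      using b0 by simp
    ultimately have *: "t mod int b + 1 < int b"
      by linarith
    have "(t + 1) mod int b = t mod int b + 1" "(t + 1) div int b = t div int b"
      using int_add_no_carry[of t "int b" 1] * b0 by simp_all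
    then have "q t \<otimes> q (t + 1) = (r (t div int b) \<otimes> r (t div int b)) \<otimes>
      (x [^] (t mod int b) \<otimes> x [^] (t mod int b + 1))"
      using x by (simp add: q_def m_ac)
    also have "x [^] (t mod int b) \<otimes> x [^] (t mod int b + 1) = x [^] (t mod int b + (t mod int b + 1))"
      using x by (simp only: int_pow_mult)
    also have "t mod int b + (t mod int b + 1) = 2 * (t mod int b) + 1"
      by simp
    finally show ?thesis
      using False by (simp only: c_def e_def if_False)
  qed
  have "hamiltonian_sequence (adjoin H x) q"
    unfolding hamiltonian_sequence_def adjoin_card[OF fin H(1) x b0 b(2)]
  proof (intro conjI allI impI)
    fix t
    show "q t \<in> adjoin H x"
      unfolding q_def adjoin_def using rH by blast
    have "(t + int (b * card H)) div int b = t div int b + int (card H)"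
      "(t + int (b * card H)) mod int b = t mod int b"
      using b0 by simp_all
    then show "q (t + int (b * card H)) = q t"
      by (simp add: q_def per)
  next
    fix s t assume eq: "q s = q t"
    then have "int b dvd s mod int b - t mod int b"
      using mult_int_pow_eq_imp_mem[OF H(1) x rH rH] b(2) by (simp add: q_def)
    then have m: "s mod int b = t mod int b"
      by (metis mod_eq_dvd_iff mod_mod_trivial)
    then have "r (s div int b) = r (t div int b)"
      using eq x by (simp add: q_def)
    then show "int (b * card H) dvd s - t"
      by (intro lift[OF m] inj)
  next
    fix s t assume "q s \<otimes> q (s + 1) = q t \<otimes> q (t + 1)"
    then have eq: "c s \<otimes> x [^] e s = c t \<otimes> x [^] e t"
      by (simp add: qq)
    then have "int b dvd e s - e t"
      using mult_int_pow_eq_imp_mem[OF H(1) x cH(1) cH(1)] b(2) by simp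
    \<comment> \<open>At the carry \<open>2 * i + 1\<close> exceeds the true exponent by exactly
      \<open>b\<close>, so modulo \<open>b\<close> the exponent is \<open>2 * i + 1\<close> in all
      cases.\<close>
    moreover have e2: "int b dvd (2 * (t mod int b) + 1) - e t" for t
      by (simp add: e_def)
    ultimately have "int b dvd (2 * (s mod int b) + 1 - e s) + (e s - e t) - (2 * (t mod int b) + 1 - e t)"
      using e2[of s] e2[of t] by (meson dvd_add dvd_diff)
    then have "int b dvd 2 * (s mod int b - t mod int b)"
      by (simp add: algebra_simps)
    moreover have "coprime (int b) 2"
      using b(1) by simp
    ultimately have "int b dvd s mod int b - t mod int b"
      using coprime_dvd_mult_right_iff by blast
    then have m: "s mod int b = t mod int b"
      by (metis mod_eq_dvd_iff mod_mod_trivial)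
    then have "e s = e t"
      by (simp add: e_def)
    then have "c s = c t"
      using eq x by simp
    then have "int (card H) dvd s div int b - t div int b"
    proof (cases "t mod int b = int b - 1")
      case True
      then show ?thesis
        using \<open>c s = c t\<close> m inj2 by (simp add: c_def)
    next
      case False
      then have "r (s div int b) \<otimes> r (s div int b) = r (t div int b) \<otimes> r (t div int b)"
        using \<open>c s = c t\<close> m by (simp only: c_def if_False)
      then show ?thesis
        by (intro inj odd_subgroup_square_cancel[OF H rH rH])
    qed
    then show "int (b * card H) dvd s - t"
      by (rule lift[OF m])
  qed
  moreover have "q = (\<lambda>t. r (t div int b) \<otimes> x [^] (t mod int b))"
    by (simp add: fun_eq_iff q_def)
  ultimately show ?thesis
    by simp
qed

text \<open>A maximal subgroup of \<open>K\<close> with a sequence absorbs every \<open>x\<close> in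
  \<open>K\<close>: the period of \<open>x\<close> modulo it divides \<open>card K\<close> and is
  therefore odd.\<close>

lemma hamiltonian_sequence_exists:
  assumes fin: "finite (carrier G)" and K: "subgroup K G" "odd (card K)"
  shows "\<exists>r. hamiltonian_sequence K r"
proof -
  interpret K: subgroup K G by fact
  interpret KG: group "G\<lparr>carrier := K\<rparr>"
    using K(1) is_group by (rule subgroup.subgroup_is_group)
  let ?P = "\<lambda>H. H \<subseteq> K \<and> odd (card H) \<and> (\<exists>r. hamiltonian_sequence H r)"
  have "?P {\<one>}"
    by (auto simp: hamiltonian_sequence_def intro!: exI[of _ "\<lambda>_. \<one>"])
  then obtain H where H: "subgroup H G" "H \<subseteq> K" "odd (card H)" "\<exists>r. hamiltonian_sequence H r"
    and max: "\<And>L. subgroup L G \<Longrightarrow> ?P L \<Longrightarrow> H \<subseteq> L \<Longrightarrow> L = H"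
    using maximal_subgroup_exists[OF fin triv_subgroup, of ?P] by metis
  have "x \<in> H" if x: "x \<in> K" for x
  proof -
    have xG: "x \<in> carrier G"
      using x by simp
    obtain b where b: "b > 0" "\<And>i::int. x [^] i \<in> H \<longleftrightarrow> int b dvd i"
      by (rule subgroup_period[OF fin H(1) xG]) blast
    have "x [^] card K = \<one>"
      using KG.pow_order_eq_1[of x] x by (simp add: order_def nat_pow_consistent[symmetric])
    then have "x [^] int (card K) \<in> H"
      using H(1) by (simp add: int_pow_int subgroup.one_closed)
    then have "odd b"
      using b K(2) by (meson dvd_trans int_dvd_int_iff)
    have "adjoin H x \<subseteq> K"
    proof
      fix u assume "u \<in> adjoin H x"
      then obtain h i where "h \<in> H" "u = h \<otimes> x [^] (i::int)"
        unfolding adjoin_def by blast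
      moreover have "x [^] i \<in> K"
        using KG.int_pow_closed[of x i] int_pow_consistent[OF K(1) x] x by simp
      ultimately show "u \<in> K"
        using H(2) by auto
    qed
    moreover have "odd (card (adjoin H x))"
      using adjoin_card[OF fin H(1) xG b] \<open>odd b\<close> H(3) by simp
    ultimately have "adjoin H x = H"
      using H hamiltonian_sequence_adjoin[OF fin H(1,3) _ xG \<open>odd b\<close> b(2)]
      by (intro max adjoin_subgroup adjoin_superset xG) blast+
    then show ?thesis
      using adjoin_superset(2)[OF H(1) xG] by simp
  qed
  then have "K = H"
    using H(2) by blast
  then show ?thesis
    using H(4) by simp
qed

text \<open>The three injective maps are the components in \<open>H\<close> of the rows, columns and
  symbols of the cells that \<open>unique_involution_coloring\<close> removes from the
  ladders.\<close>

definition strong_map :: "'a set \<Rightarrow> ('a \<Rightarrow> 'a) \<Rightarrow> bool" where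
  "strong_map H f \<longleftrightarrow> f ` H \<subseteq> H \<and> inj_on f H \<and> inj_on (\<lambda>k. f k \<otimes> k) H \<and>
     inj_on (\<lambda>k. f k \<otimes> (f k \<otimes> k)) H"

text \<open>The new map sends \<open>h \<otimes> \<tau> i\<close> to
  \<open>f h \<otimes> \<xi> i\<close>. Each of the three maps then has a factor from
  \<open>H\<close>, injective by the choice of \<open>f\<close>, and a factor whose coset determines
  \<open>i\<close> by \<open>d1\<close>, \<open>d2\<close> or \<open>d3\<close>.\<close>

lemma strong_map_extend:
  assumes H: "subgroup H G" and K: "subgroup K G" "H \<subseteq> K" and f: "strong_map H f"
    and mem: "\<And>i. i \<in> I \<Longrightarrow> \<tau> i \<in> K \<and> \<xi> i \<in> K"
    and cover: "\<And>k. k \<in> K \<Longrightarrow> \<exists>h\<in>H. \<exists>i\<in>I. k = h \<otimes> \<tau> i"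
    and d1: "\<And>h h' i i'. \<lbrakk>h \<in> H; h' \<in> H; i \<in> I; i' \<in> I; h \<otimes> \<xi> i = h' \<otimes> \<xi> i'\<rbrakk> \<Longrightarrow> i = i'"
    and d2: "\<And>h h' i i'. \<lbrakk>h \<in> H; h' \<in> H; i \<in> I; i' \<in> I;
      h \<otimes> (\<xi> i \<otimes> \<tau> i) = h' \<otimes> (\<xi> i' \<otimes> \<tau> i')\<rbrakk> \<Longrightarrow> i = i'"
    and d3: "\<And>h h' i i'. \<lbrakk>h \<in> H; h' \<in> H; i \<in> I; i' \<in> I;
      h \<otimes> (\<xi> i \<otimes> (\<xi> i \<otimes> \<tau> i)) = h' \<otimes> (\<xi> i' \<otimes> (\<xi> i' \<otimes> \<tau> i'))\<rbrakk> \<Longrightarrow> i = i'"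
  shows "\<exists>f'. strong_map K f'"
proof -
  interpret H: subgroup H G by fact
  interpret K: subgroup K G by fact
  have "\<forall>k\<in>K. \<exists>hi. fst hi \<in> H \<and> snd hi \<in> I \<and> k = fst hi \<otimes> \<tau> (snd hi)"
    using cover by fastforce
  then obtain hi where hi: "\<And>k. k \<in> K \<Longrightarrow> fst (hi k) \<in> H \<and> snd (hi k) \<in> I \<and>
      k = fst (hi k) \<otimes> \<tau> (snd (hi k))"
    by (metis bchoice)
  define p where "p k = fst (hi k)" for k
  define q where "q k = snd (hi k)" for k
  have p: "p k \<in> H" and q: "q k \<in> I" and k: "k = p k \<otimes> \<tau> (q k)" if "k \<in> K" for k
    using hi[OF that] by (simp_all add: p_def q_def)
  have fH: "f h \<in> H" if "h \<in> H" for h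
    using f that by (auto simp: strong_map_def)
  define f' where "f' k = f (p k) \<otimes> \<xi> (q k)" for k
  have KG: "\<xi> i \<in> carrier G" "\<tau> i \<in> carrier G" if "i \<in> I" for i
    using mem[OF that] by auto
  have HG: "h \<in> carrier G" if "h \<in> H" for h
    using that by simp
  have e2: "f' k \<otimes> k = (f (p k) \<otimes> p k) \<otimes> (\<xi> (q k) \<otimes> \<tau> (q k))" if "k \<in> K" for k
  proof -
    have "f' k \<otimes> k = f' k \<otimes> (p k \<otimes> \<tau> (q k))"
      using k[OF that] by simp
    then show ?thesis
      using HG[OF fH[OF p[OF that]]] HG[OF p[OF that]] KG[OF q[OF that]] by (simp add: f'_def m_ac)
  qed
  have e3: "f' k \<otimes> (f' k \<otimes> k) = (f (p k) \<otimes> (f (p k) \<otimes> p k)) \<otimes> (\<xi> (q k) \<otimes> (\<xi> (q k) \<otimes> \<tau> (q k)))"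
    if "k \<in> K" for k
    using HG[OF fH[OF p[OF that]]] HG[OF p[OF that]] KG[OF q[OF that]]
    unfolding e2[OF that] by (simp add: f'_def m_ac)
  have inj: "inj_on (\<lambda>k. F (p k) \<otimes> \<Xi> (q k)) K"
    if F: "inj_on F H" "\<And>h. h \<in> H \<Longrightarrow> F h \<in> H" "\<And>i. i \<in> I \<Longrightarrow> \<Xi> i \<in> carrier G"
      and d: "\<And>h h' i i'. \<lbrakk>h \<in> H; h' \<in> H; i \<in> I; i' \<in> I; h \<otimes> \<Xi> i = h' \<otimes> \<Xi> i'\<rbrakk> \<Longrightarrow> i = i'"
    for F \<Xi>
  proof (rule inj_onI)
    fix k k' assume kk: "k \<in> K" "k' \<in> K" and eq: "F (p k) \<otimes> \<Xi> (q k) = F (p k') \<otimes> \<Xi> (q k')"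
    then have "q k = q k'"
      by (intro d[OF F(2) F(2) _ _ eq] p q)
    with eq have "F (p k) = F (p k')"
      using F(2)[OF p[OF kk(1)]] F(2)[OF p[OF kk(2)]] F(3)[OF q[OF kk(2)]] by simp
    then have "p k = p k'"
      using inj_onD[OF F(1)] p kk by blast
    then show "k = k'"
      using k[OF kk(1)] k[OF kk(2)] \<open>q k = q k'\<close> by metis
  qed
  have "inj_on f' K"
    unfolding f'_def using f fH KG d1 by (intro inj) (auto simp: strong_map_def)
  moreover have "inj_on (\<lambda>k. f' k \<otimes> k) K"
  proof -
    have "inj_on (\<lambda>k. (f (p k) \<otimes> p k) \<otimes> (\<xi> (q k) \<otimes> \<tau> (q k))) K"
      using inj[of "\<lambda>h. f h \<otimes> h" "\<lambda>i. \<xi> i \<otimes> \<tau> i"] f fH KG d2 by (simp add: strong_map_def)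
    then show ?thesis
      by (simp add: e2 cong: inj_on_cong)
  qed
  moreover have "inj_on (\<lambda>k. f' k \<otimes> (f' k \<otimes> k)) K"
  proof -
    have "inj_on (\<lambda>k. (f (p k) \<otimes> (f (p k) \<otimes> p k)) \<otimes> (\<xi> (q k) \<otimes> (\<xi> (q k) \<otimes> \<tau> (q k)))) K"
      using inj[of "\<lambda>h. f h \<otimes> (f h \<otimes> h)" "\<lambda>i. \<xi> i \<otimes> (\<xi> i \<otimes> \<tau> i)"] f fH KG d3
      by (simp add: strong_map_def)
    then show ?thesis
      by (simp add: e3 cong: inj_on_cong)
  qed
  moreover have "f' ` K \<subseteq> K"
    unfolding f'_def using p q fH mem K(2) by (meson K.m_closed image_subsetI subsetD)
  ultimately show ?thesis
    by (auto simp: strong_map_def)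
qed

section \<open>Extending strong maps by elements of prime order modulo \<open>H\<close>\<close>

lemma prime_period:
  assumes fin: "finite (carrier G)" and H: "subgroup H G" and x: "x \<in> carrier G" "x \<notin> H"
    and p: "Factorial_Ring.prime p" "x [^] (p::nat) \<in> H"
  shows "x [^] (i::int) \<in> H \<longleftrightarrow> int p dvd i"
proof -
  obtain b where b: "b > 0" "\<And>i::int. x [^] i \<in> H \<longleftrightarrow> int b dvd i"
    by (rule subgroup_period[OF fin H x(1)]) blast
  have "x [^] int p \<in> H" "x [^] (1::int) \<notin> H"
    using p x by (simp_all add: int_pow_int)
  then have "b dvd p" "b \<noteq> 1"
    using b(2) by auto
  then have "b = p"
    using p(1) by (metis prime_nat_iff)
  then show ?thesis
    using b(2) by simp
qed

lemma adjoin_prime_cases: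
  assumes fin: "finite (carrier G)" and H: "subgroup H G" and x: "x \<in> carrier G" "x \<notin> H"
    and p: "Factorial_Ring.prime p" "x [^] (p::nat) \<in> H" and k: "k \<in> adjoin H x"
  shows "\<exists>h\<in>H. \<exists>i\<in>{0..<int p}. k = h \<otimes> x [^] i"
proof -
  interpret H: subgroup H G by fact
  obtain h i where *: "h \<in> H" "k = h \<otimes> x [^] (i::int)"
    using k unfolding adjoin_def by blast
  have "x [^] i = x [^] (int p * (i div int p) + i mod int p)"
    by simp
  also have "\<dots> = x [^] (int p * (i div int p)) \<otimes> x [^] (i mod int p)"
    using x by (simp only: int_pow_mult)
  finally have "k = (h \<otimes> x [^] (int p * (i div int p))) \<otimes> x [^] (i mod int p)"
    using * x by (simp add: m_assoc)
  moreover have "x [^] (int p * (i div int p)) \<in> H"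
    using prime_period[OF fin H x p] by simp
  moreover have "i mod int p \<in> {0..<int p}"
    using prime_gt_0_nat[OF p(1)] by simp
  ultimately show ?thesis
    using * H.m_closed by blast
qed

text \<open>With \<open>\<xi> i = \<tau> i = x [^] i\<close> the exponents of the three maps are
  \<open>i\<close>, \<open>2 * i\<close> and \<open>3 * i\<close>, and 1, 2, 3 are invertible modulo
  a prime \<open>p \<ge> 5\<close>.\<close>

lemma strong_map_adjoin_prime:
  assumes fin: "finite (carrier G)" and H: "subgroup H G" and f: "strong_map H f"
    and x: "x \<in> carrier G" "x \<notin> H"
    and p: "Factorial_Ring.prime p" "x [^] (p::nat) \<in> H" "p \<ge> 5"
  shows "\<exists>f'. strong_map (adjoin H x) f'"
proof (rule strong_map_extend[OF H adjoin_subgroup[OF H x(1)] adjoin_superset(1)[OF H x(1)] f])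
  have pow: "x [^] i \<in> H \<longleftrightarrow> int p dvd i" for i :: int
    by (rule prime_period[OF fin H x p(1,2)])
  have one: "\<one> \<in> H"
    using H by (rule subgroup.one_closed)
  have mem: "x [^] i \<in> adjoin H x" for i :: int
  proof -
    have "x [^] i = \<one> \<otimes> x [^] i"
      using x by simp
    then show ?thesis
      unfolding adjoin_def using one by blast
  qed
  have dist: "i = i'"
    if "h \<in> H" "h' \<in> H" "i \<in> {0..<int p}" "i' \<in> {0..<int p}"
      "h \<otimes> x [^] (c * i) = h' \<otimes> x [^] (c * i')" "c \<in> {1, 2, 3}" for h h' i i' c
  proof -
    have "int p dvd c * i - c * i'"
      using mult_int_pow_eq_imp_mem[OF H x(1) that(1,2,5)] pow by simp
    then have "int p dvd c * (i - i')"
      by (simp add: right_diff_distrib)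
    moreover have "\<not> int p dvd c"
      using that(6) p(3) by (auto dest: zdvd_imp_le)
    moreover have "Factorial_Ring.prime (int p)"
      using p(1) by simp
    ultimately have "int p dvd i - i'"
      using prime_dvd_mult_iff by blast
    then show ?thesis
      using int_dvd_diff_imp_eq that(3,4) by blast
  qed
  show "x [^] i \<in> adjoin H x \<and> x [^] i \<in> adjoin H x" if "i \<in> {0..<int p}" for i
    using mem by blast
  show "\<exists>h\<in>H. \<exists>i\<in>{0..<int p}. k = h \<otimes> x [^] i" if "k \<in> adjoin H x" for k
    by (rule adjoin_prime_cases[OF fin H x p(1,2) that])
  show "i = i'" if "h \<in> H" "h' \<in> H" "i \<in> {0..<int p}" "i' \<in> {0..<int p}"
    "h \<otimes> x [^] i = h' \<otimes> x [^] i'" for h h' i i'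
    using that by (intro dist[of h h' i i' 1]) auto
  show "i = i'" if "h \<in> H" "h' \<in> H" "i \<in> {0..<int p}" "i' \<in> {0..<int p}"
    "h \<otimes> (x [^] i \<otimes> x [^] i) = h' \<otimes> (x [^] i' \<otimes> x [^] i')" for h h' i i'
  proof -
    have "x [^] (2 * i) = x [^] i \<otimes> x [^] i" for i :: int
      using x(1) by (simp only: mult_2 int_pow_mult)
    then show ?thesis
      using that by (intro dist[of h h' i i' 2]) simp_all
  qed
  show "i = i'" if "h \<in> H" "h' \<in> H" "i \<in> {0..<int p}" "i' \<in> {0..<int p}"
    "h \<otimes> (x [^] i \<otimes> (x [^] i \<otimes> x [^] i)) = h' \<otimes> (x [^] i' \<otimes> (x [^] i' \<otimes> x [^] i'))" for h h' i i'
  proof -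
    have "x [^] (3 * i) = x [^] i \<otimes> (x [^] i \<otimes> x [^] i)" for i :: int
    proof -
      have *: "3 * i = i + (i + i)"
        by simp
      show ?thesis
        unfolding * using x(1) by (simp only: int_pow_mult)
    qed
    then show ?thesis
      using that by (intro dist[of h h' i i' 3]) simp_all
  qed
qed

text \<open>A single factor of order 3 admits no multiplier \<open>c\<close>, since one of
  \<open>c\<close>, \<open>c + 1\<close>, \<open>2 * c + 1\<close> is divisible by 3. Two factors
  independent modulo \<open>H\<close> form a plane, where a linear map can take the place of
  \<open>c\<close>.\<close>

lemma strong_map_adjoin_two:
  assumes fin: "finite (carrier G)" and H: "subgroup H G" and f: "strong_map H f"
    and x: "x \<in> carrier G" "x \<notin> H" "x [^] (3::nat) \<in> H"
    and y: "y \<in> carrier G" "y \<notin> adjoin H x" "y [^] (3::nat) \<in> H"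
  shows "\<exists>f'. strong_map (adjoin (adjoin H x) y) f'"
proof -
  let ?H = "adjoin H x"
  let ?K = "adjoin ?H y"
  interpret H: subgroup H G by fact
  have H1: "subgroup ?H G"
    by (rule adjoin_subgroup[OF H x(1)])
  have K1: "subgroup ?K G"
    by (rule adjoin_subgroup[OF H1 y(1)])
  have sub: "H \<subseteq> ?H" "?H \<subseteq> ?K"
    using adjoin_superset H H1 x y by auto
  have three: "Factorial_Ring.prime (3::nat)"
    by simp
  have y3: "y [^] (3::nat) \<in> ?H" "y \<notin> H"
    using y sub by auto
  have powx: "x [^] i \<in> H \<longleftrightarrow> 3 dvd i" for i :: int
    using prime_period[OF fin H x(1,2) three x(3)] by simp
  have powy: "y [^] i \<in> ?H \<longleftrightarrow> 3 dvd i" for i :: int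
    using prime_period[OF fin H1 y(1,2) three y3(1)] by simp
  have powy': "y [^] i \<in> H \<longleftrightarrow> 3 dvd i" for i :: int
    using prime_period[OF fin H y(1) y3(2) three y(3)] by simp
  have mem1: "h \<otimes> x [^] i \<in> ?H" if "h \<in> H" for h and i :: int
    unfolding adjoin_def using that by blast
  have mem: "x [^] i \<otimes> y [^] j \<in> ?K" for i j :: int
    using mem1[OF H.one_closed, of i] x y unfolding adjoin_def[of ?H] by auto
  \<comment> \<open>The powers of \<open>y\<close> are compared first, modulo
    \<open>adjoin H x\<close>. Their quotient then has an exponent divisible by 3 and lies in
    \<open>H\<close>, so the powers of \<open>x\<close> can be compared modulo
    \<open>H\<close>.\<close>
  have dist: "3 dvd i - i' \<and> 3 dvd j - j'"
    if hh: "h \<in> H" "h' \<in> H" and eq: "h \<otimes> (x [^] i \<otimes> y [^] j) = h' \<otimes> (x [^] i' \<otimes> y [^] j')"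
    for h h' and i j i' j' :: int
  proof -
    have eq': "(h \<otimes> x [^] i) \<otimes> y [^] j = (h' \<otimes> x [^] i') \<otimes> y [^] j'"
      using eq hh x y by (simp add: m_assoc)
    have j: "3 dvd j - j'"
      using mult_int_pow_eq_imp_mem[OF H1 y(1) mem1 mem1 eq'] hh powy by simp
    have "(h \<otimes> y [^] (j - j')) \<otimes> x [^] i = ((h \<otimes> x [^] i) \<otimes> y [^] j) \<otimes> inv (y [^] j')"
      using hh x y by (simp add: int_pow_diff m_ac)
    also have "\<dots> = h' \<otimes> x [^] i'"
      unfolding eq' using hh x y by (simp add: m_assoc)
    finally have "x [^] (i - i') \<in> H"
      using hh j powy' by (intro mult_int_pow_eq_imp_mem[OF H x(1), of "h \<otimes> y [^] (j - j')" h']) auto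
    then show ?thesis
      using powx j by simp
  qed
  let ?\<tau> = "\<lambda>(i, j). x [^] i \<otimes> y [^] (j::int)"
  \<comment> \<open>On exponents \<open>\<xi>\<close> is a quarter turn of the plane over the field with three elements, so \<open>\<xi>\<close>,
    \<open>\<xi> + 1\<close> and \<open>2 \<xi> + 1\<close> are invertible.\<close>
  let ?\<xi> = "\<lambda>(i, j). x [^] (2 * j) \<otimes> y [^] (i::int)"
  have small: "i = i'" if "i \<in> {0..<3::int}" "i' \<in> {0..<3}" "3 dvd i - i'" for i i'
    using int_dvd_diff_imp_eq that by blast
  show ?thesis
  proof (rule strong_map_extend[OF H K1 _ f, where I = "{0..<3::int} \<times> {0..<3::int}" and \<tau> = ?\<tau> and \<xi> = ?\<xi>])
    show "H \<subseteq> ?K"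
      using sub by blast
    show "?\<tau> ij \<in> ?K \<and> ?\<xi> ij \<in> ?K" if "ij \<in> {0..<3::int} \<times> {0..<3::int}" for ij
      using mem by (cases ij) simp
    show "\<exists>h\<in>H. \<exists>ij\<in>{0..<3::int} \<times> {0..<3::int}. k = h \<otimes> ?\<tau> ij" if kK: "k \<in> ?K" for k
    proof -
      obtain k' j where k': "k' \<in> ?H" "j \<in> {0..<3::int}" "k = k' \<otimes> y [^] j"
        using adjoin_prime_cases[OF fin H1 y(1,2) three y3(1) kK] by auto
      obtain h i where h: "h \<in> H" "i \<in> {0..<3::int}" "k' = h \<otimes> x [^] i"
        using adjoin_prime_cases[OF fin H x(1,2) three x(3) k'(1)] by auto
      have "k = h \<otimes> ?\<tau> (i, j)"
        using k' h x y by (simp add: m_assoc)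
      then show ?thesis
        using h k' by blast
    qed
  next
    fix h h' ij ij'
    assume hh: "h \<in> H" "h' \<in> H" and I: "ij \<in> {0..<3::int} \<times> {0..<3::int}" "ij' \<in> {0..<3::int} \<times> {0..<3::int}"
    obtain i j i' j' where ij: "ij = (i, j)" "ij' = (i', j')"
      by (cases ij; cases ij') blast
    have b: "i \<in> {0..<3}" "j \<in> {0..<3}" "i' \<in> {0..<3}" "j' \<in> {0..<3}"
      using I ij by auto
    have t2: "x [^] (2 * j) \<otimes> y [^] i \<otimes> (x [^] i \<otimes> y [^] j) = x [^] (i + 2 * j) \<otimes> y [^] (i + j)" for i j :: int
      using x y by (simp add: int_pow_mult m_ac)
    have t3: "x [^] (2 * j) \<otimes> y [^] i \<otimes> (x [^] (i + 2 * j) \<otimes> y [^] (i + j)) =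
      x [^] (i + 4 * j) \<otimes> y [^] (2 * i + j)" for i j :: int
    proof -
      have *: "i + 4 * j = 2 * j + (i + 2 * j)" "2 * i + j = i + (i + j)"
        by simp_all
      show ?thesis
        unfolding * using x y by (simp only: int_pow_mult m_ac int_pow_closed m_closed)
    qed
    { assume "h \<otimes> ?\<xi> ij = h' \<otimes> ?\<xi> ij'"
      then have "3 dvd 2 * j - 2 * j' \<and> 3 dvd i - i'"
        using hh by (intro dist) (simp_all add: ij)
      then have "3 dvd 2 * (j - j')" "3 dvd i - i'"
        by (simp_all add: algebra_simps)
      then have "3 dvd j - j'" "3 dvd i - i'"
        using three_dvd_linear by blast+
      then show "ij = ij'"
        using b small unfolding ij by blast }
    { assume "h \<otimes> (?\<xi> ij \<otimes> ?\<tau> ij) = h' \<otimes> (?\<xi> ij' \<otimes> ?\<tau> ij')"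
      then have "3 dvd (i + 2 * j) - (i' + 2 * j') \<and> 3 dvd (i + j) - (i' + j')"
        using hh by (intro dist) (simp_all add: ij t2)
      then have "3 dvd (i - i') + 2 * (j - j')" "3 dvd (i - i') + (j - j')"
        by (simp_all add: algebra_simps)
      then have "3 dvd j - j'" "3 dvd i - i'"
        using three_dvd_linear by blast+
      then show "ij = ij'"
        using b small unfolding ij by blast }
    { assume "h \<otimes> (?\<xi> ij \<otimes> (?\<xi> ij \<otimes> ?\<tau> ij)) = h' \<otimes> (?\<xi> ij' \<otimes> (?\<xi> ij' \<otimes> ?\<tau> ij'))"
      then have "3 dvd (i + 4 * j) - (i' + 4 * j') \<and> 3 dvd (2 * i + j) - (2 * i' + j')"
        using hh by (intro dist) (simp_all add: ij t2 t3)
      then have "3 dvd (i - i') + 4 * (j - j')" "3 dvd 2 * (i - i') + (j - j')"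
        by (simp_all add: algebra_simps)
      then have "3 dvd j - j'" "3 dvd i - i'"
        using three_dvd_linear by blast+
      then show "ij = ij'"
        using b small unfolding ij by blast }
  qed
qed

lemma adjoin_prime_odd:
  assumes fin: "finite (carrier G)" and H: "subgroup H G" "odd (card H)" and x: "x \<in> carrier G" "x \<notin> H"
    and p: "Factorial_Ring.prime p" "x [^] (p::nat) \<in> H" "odd p"
  shows "odd (card (adjoin H x))"
  using adjoin_card[OF fin H(1) x(1) prime_gt_0_nat[OF p(1)] prime_period[OF fin H(1) x p(1,2)]] H(2) p(3)
  by simp

text \<open>For \<open>H\<close> maximal of odd order with a strong map, the prime criterion for a
  cyclic quotient holds: a prime \<open>p \<ge> 5\<close> would allow an extension,
  \<open>p = 3\<close> would allow one by two independent elements, and for \<open>p = 2\<close> the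
  only new coset is that of \<open>z\<close>.\<close>

lemma strong_subgroup_cyclic_quotient:
  assumes fin: "finite (carrier G)" and z: "z \<in> carrier G" "z \<otimes> z = \<one>"
    and uniq: "\<And>u. u \<in> carrier G \<Longrightarrow> u \<otimes> u = \<one> \<Longrightarrow> u = \<one> \<or> u = z"
  shows "\<exists>H f g. subgroup H G \<and> odd (card H) \<and> strong_map H f \<and> g \<in> carrier G \<and>
    (\<forall>x\<in>carrier G. \<exists>i::int. \<exists>h\<in>H. x = h \<otimes> g [^] i)"
proof -
  let ?P = "\<lambda>H. odd (card H) \<and> (\<exists>f. strong_map H f)"
  have "?P {\<one>}"
    by (auto simp: strong_map_def intro!: exI[of _ "\<lambda>_. \<one>"])
  then obtain H where H: "subgroup H G" "odd (card H)" "\<exists>f. strong_map H f"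
    and max: "\<And>L. subgroup L G \<Longrightarrow> ?P L \<Longrightarrow> H \<subseteq> L \<Longrightarrow> L = H"
    using maximal_subgroup_exists[OF fin triv_subgroup, of ?P] by metis
  interpret H: subgroup H G by fact
  obtain f where f: "strong_map H f"
    using H(3) by blast
  have "\<exists>g\<in>carrier G. \<forall>x\<in>carrier G. \<exists>i::int. \<exists>h\<in>H. x = h \<otimes> g [^] i"
  proof (rule cyclic_quotient_if_unique_prime_subgroups[OF fin H(1)])
    fix p :: nat and x y
    assume p: "Factorial_Ring.prime p" and x: "x \<in> carrier G" and y: "y \<in> carrier G"
      and xp: "x [^] p \<in> H" and yp: "y [^] p \<in> H" and xH: "x \<notin> H"
    have "p = 2 \<or> p = 3 \<or> p \<ge> 5"
    proof -
      have "p \<noteq> 4"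
        using p by auto
      then show ?thesis
        using prime_ge_2_nat[OF p] by linarith
    qed
    then show "\<exists>i::int. \<exists>h\<in>H. y = h \<otimes> x [^] i"
    proof (elim disjE)
      assume p2: "p = 2"
      \<comment> \<open>Squaring permutes \<open>H\<close>, so \<open>u \<otimes> u\<close> is also
        the square of some \<open>s\<close> in \<open>H\<close>, and
        \<open>u \<otimes> inv s\<close> squares to one.\<close>
      have root: "u \<in> H \<or> (\<exists>h\<in>H. u = h \<otimes> z)" if u: "u \<in> carrier G" "u [^] (2::nat) \<in> H" for u
      proof -
        have "inj_on (\<lambda>s. s \<otimes> s) H"
          by (rule inj_onI) (rule odd_subgroup_square_cancel[OF H(1,2)])
        moreover have "finite H"
          using fin H.subset finite_subset by blast
        moreover have "(\<lambda>s. s \<otimes> s) ` H \<subseteq> H"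
          by (intro image_subsetI H.m_closed)
        ultimately have "(\<lambda>s. s \<otimes> s) ` H = H"
          by (intro endo_inj_surj)
        moreover have "u \<otimes> u \<in> H"
          using u by (simp add: numeral_2_eq_2)
        ultimately obtain s where s: "s \<in> H" "s \<otimes> s = u \<otimes> u"
          by (metis (no_types, lifting) imageE)
        have "(u \<otimes> inv s) \<otimes> (u \<otimes> inv s) = (u \<otimes> u) \<otimes> inv (s \<otimes> s)"
          using s(1) u by (simp add: inv_mult m_ac)
        also have "\<dots> = \<one>"
          unfolding s(2) using u by simp
        finally have "u \<otimes> inv s = \<one> \<or> u \<otimes> inv s = z"
          using uniq s(1) u by simp
        moreover have "u = s \<otimes> (u \<otimes> inv s)"
          using u(1) s(1) by (simp add: m_lcomm[of s u])
        ultimately show ?thesis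
          using s(1) by (metis H.mem_carrier r_one)
      qed
      obtain h where h: "h \<in> H" "x = h \<otimes> z"
        using root[OF x] xp xH p2 by auto
      show ?thesis
      proof (cases "y \<in> H")
        case True
        then have "y = y \<otimes> x [^] (0::int)"
          by simp
        then show ?thesis
          using True by blast
      next
        case False
        then obtain k where k: "k \<in> H" "y = k \<otimes> z"
          using root[OF y] yp p2 by auto
        have "inv h \<otimes> (h \<otimes> z) = z"
          using h(1) z(1) by (simp add: m_assoc[symmetric])
        then have "y = (k \<otimes> inv h) \<otimes> x [^] (1::int)"
          using h k z(1) x by (simp add: m_assoc)
        then show ?thesis
          using h k H.m_closed H.m_inv_closed by blast
      qed
    next
      assume p3: "p = 3"
      show ?thesis
      proof (rule ccontr)
        assume "\<not> ?thesis"
        then have y': "y \<notin> adjoin H x"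
          unfolding adjoin_def by blast
        have H1: "subgroup (adjoin H x) G"
          by (rule adjoin_subgroup[OF H(1) x])
        have sub: "H \<subseteq> adjoin H x" "adjoin H x \<subseteq> adjoin (adjoin H x) y"
          using adjoin_superset H(1) H1 x y by auto
        have "odd (card (adjoin H x))"
          using adjoin_prime_odd[OF fin H(1,2) x xH p xp] p3 by simp
        then have "odd (card (adjoin (adjoin H x) y))"
          using adjoin_prime_odd[OF fin H1 _ y y' p] yp sub p3 by auto
        moreover have "\<exists>f'. strong_map (adjoin (adjoin H x) y) f'"
          using strong_map_adjoin_two[OF fin H(1) f x xH _ y y'] xp yp p3 by simp
        ultimately have "adjoin (adjoin H x) y = H"
          using sub by (intro max adjoin_subgroup H1 y) auto
        then show False
          using y' sub adjoin_superset(2)[OF H1 y] by blast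
      qed
    next
      assume p5: "p \<ge> 5"
      then have "odd p"
        using p prime_odd_nat by simp
      then have "odd (card (adjoin H x))"
        by (rule adjoin_prime_odd[OF fin H(1,2) x xH p xp])
      moreover have "\<exists>f'. strong_map (adjoin H x) f'"
        by (rule strong_map_adjoin_prime[OF fin H(1) f x xH p xp p5])
      ultimately have "adjoin H x = H"
        using adjoin_superset[OF H(1) x] by (intro max adjoin_subgroup H(1) x) auto
      then show ?thesis
        using adjoin_superset(2)[OF H(1) x] xH by simp
    qed
  qed
  then show ?thesis
    using H(1,2) f by blast
qed

end

section \<open>The ladders\<close>

context comm_group
begin

text \<open>The ladder of \<open>c\<close> has cells \<open>(w t, w t \<otimes> c)\<close> of a
  first kind and \<open>(w t, w (t + 1) \<otimes> c)\<close> of a second. \<open>T c (a c)\<close>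
  takes the first kind along one half period and the second kind along the other, and
  \<open>T c (a c + m)\<close> does the opposite. \<open>parity\<close> separates symbols of
  different kinds; the two cells removed from each ladder go to \<open>U0\<close> and
  \<open>U1\<close>, and \<open>sel\<close> makes \<open>U0\<close> a transversal.\<close>

lemma ladder_coloring:
  fixes m :: int and w :: "int \<Rightarrow> 'a" and a d :: "'a \<Rightarrow> int"
  assumes m: "m \<ge> 1" and w: "\<And>t. w t \<in> carrier G" and E: "E \<subseteq> carrier G" "finite E"
    and z: "z \<in> carrier G" "z \<otimes> z = \<one>"
    and uniq: "\<And>u. u \<in> carrier G \<Longrightarrow> u \<otimes> u = \<one> \<Longrightarrow> u = \<one> \<or> u = z"
    and shift: "\<And>t. w (t + m) = w t \<otimes> z"
    and inj: "\<And>s t. w s = w t \<Longrightarrow> 2 * m dvd s - t"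
    and sum: "\<And>s t. w s \<otimes> w (s + 1) = w t \<otimes> w (t + 1) \<Longrightarrow> m dvd s - t"
    and parity: "\<And>s t c c'. c \<in> E \<Longrightarrow> c' \<in> E \<Longrightarrow> w s \<otimes> (w s \<otimes> c) \<noteq> w t \<otimes> (w (t + 1) \<otimes> c')"
    and cover: "\<And>x y. x \<in> carrier G \<Longrightarrow> y \<in> carrier G \<Longrightarrow>
      \<exists>t. \<exists>c\<in>E. x = w t \<and> (y = w t \<otimes> c \<or> y = w (t + 1) \<otimes> c)"
    and d: "\<And>c. c \<in> E \<Longrightarrow> d c \<in> {0, 1}"
    and sel: "\<And>c c'. c \<in> E \<Longrightarrow> c' \<in> E \<Longrightarrow> w (a c - d c) = w (a c' - d c') \<or> w (a c) \<otimes> c = w (a c') \<otimes> c' \<or>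
      w (a c - d c) \<otimes> (w (a c) \<otimes> c) = w (a c' - d c') \<otimes> (w (a c') \<otimes> c') \<Longrightarrow> c = c'"
  shows "\<exists>\<S>. finite \<S> \<and> card \<S> \<le> 2 * card E + 2 \<and> (\<forall>S\<in>\<S>. cayley_transversal G S) \<and>
    carrier G \<times> carrier G \<subseteq> \<Union>\<S>"
proof -
  note [simp] = w
  have cE: "c \<in> carrier G" if "c \<in> E" for c
    using that E by blast
  have period: "w (t + 2 * m) = w t" for t
  proof -
    have "w (t + 2 * m) = w ((t + m) + m)"
      by (simp add: algebra_simps)
    also have "\<dots> = w t \<otimes> (z \<otimes> z)"
      unfolding shift using z(1) by (simp add: m_assoc)
    finally show ?thesis
      using z by simp
  qed
  have period_mult: "w (t + 2 * m * k) = w t" for t k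
  proof (induction k rule: int_induct[where k = 0])
    case (step1 i)
    then show ?case
      using period[of "t + 2 * m * i"] by (simp add: algebra_simps)
  next
    case (step2 i)
    then show ?case
      using period[of "t + 2 * m * (i - 1)"] by (simp add: algebra_simps)
  qed simp
  have small: "k = 0" if "l dvd k" "\<bar>k\<bar> < l" for k l :: int
    using that dvd_imp_le_int[of k l] by linarith
  \<comment> \<open>Elements with equal squares differ by \<open>\<one>\<close> or \<open>z\<close>,
    hence their positions by a multiple of half the period.\<close>
  have square: "m dvd s - t" if eq: "w s \<otimes> w s = w t \<otimes> w t" for s t
  proof -
    let ?u = "w s \<otimes> inv (w t)"
    have "?u \<otimes> ?u = (w s \<otimes> w s) \<otimes> inv (w t \<otimes> w t)"
      by (simp add: inv_mult m_ac)
    also have "\<dots> = \<one>"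
      unfolding eq by simp
    finally have "?u = \<one> \<or> ?u = z"
      using uniq by simp
    moreover have "w s = ?u \<otimes> w t"
      by (simp add: m_assoc)
    ultimately have "w s = \<one> \<otimes> w t \<or> w s = z \<otimes> w t"
      by metis
    then have "w s = w t \<or> w s = w (t + m)"
      using z by (auto simp: shift m_comm)
    then have "2 * m dvd s - t \<or> 2 * m dvd s - (t + m)"
      using inj by blast
    then have "m dvd s - t \<or> m dvd (s - (t + m)) + m"
      by (metis dvd_add dvd_mult_right dvd_refl)
    then show ?thesis
      by simp
  qed
  define v where "v b s = (if s < b + m then w s else w (s + 1))" for b s
  have vG [simp]: "v b s \<in> carrier G" for b s
    by (simp add: v_def)
  \<comment> \<open>Over the full period from \<open>b\<close> on, the column
    \<open>w b \<otimes> c\<close> would occur twice: at \<open>b\<close> in a cell of the first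
    kind and at \<open>b + 2 * m - 1\<close> in one of the second. The value 0 of \<open>d c\<close>
    drops the former and 1 the latter; \<open>cell c b\<close> is the dropped one.\<close>
  define T where "T c b = (\<lambda>s. (w s, v b s \<otimes> c)) ` {b + 1 - d c..<b + 2 * m - d c}" for c b
  define cell where "cell c b = (w (b - d c), w b \<otimes> c)" for c b
  define U0 where "U0 = (\<lambda>c. cell c (a c)) ` E"
  define U1 where "U1 = (\<lambda>c. cell c (a c + m)) ` E"
  have T: "cayley_transversal G (T c b)" if c: "c \<in> E" for c b
  proof -
    have less: False
      if st: "b + 1 - d c \<le> s" "s < t" "t < b + 2 * m - d c"
        and eq: "w s = w t \<or> v b s \<otimes> c = v b t \<otimes> c \<or> w s \<otimes> (v b s \<otimes> c) = w t \<otimes> (v b t \<otimes> c)" for s t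
    proof -
      have d01: "0 \<le> d c" "d c \<le> 1"
        using d[OF c] by auto
      have row: "w s \<noteq> w t"
        using inj[of s t] small[of "2 * m" "s - t"] st d01 by auto
      consider "t < b + m" | "b + m \<le> s" | "s < b + m" "b + m \<le> t"
        by linarith
      then show False
      proof cases
        case 1
        then have v: "v b s = w s" "v b t = w t"
          using st by (simp_all add: v_def)
        have "w s \<otimes> (w s \<otimes> c) = w t \<otimes> (w t \<otimes> c)"
          using eq row cE[OF c] unfolding v by auto
        then have "w s \<otimes> w s = w t \<otimes> w t"
          using cE[OF c] by (simp add: m_assoc[symmetric])
        then show False
          using square[of s t] small[of m "s - t"] st 1 d01 by auto
      next
        case 2
        then have v: "v b s = w (s + 1)" "v b t = w (t + 1)"
          using st by (simp_all add: v_def)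
        have "w (s + 1) \<noteq> w (t + 1)"
          using inj[of "s + 1" "t + 1"] small[of "2 * m" "s - t"] st d01 by auto
        then have "w s \<otimes> (w (s + 1) \<otimes> c) = w t \<otimes> (w (t + 1) \<otimes> c)"
          using eq row cE[OF c] unfolding v by auto
        then have "w s \<otimes> w (s + 1) = w t \<otimes> w (t + 1)"
          using cE[OF c] by (simp add: m_assoc[symmetric])
        then show False
          using sum[of s t] small[of m "s - t"] st 2 d01 by auto
      next
        case 3
        then have v: "v b s = w s" "v b t = w (t + 1)"
          using st by (simp_all add: v_def)
        have "w s \<noteq> w (t + 1)"
          using inj[of s "t + 1"] small[of "2 * m" "s - (t + 1)"] st d01 3 by auto
        then show False
          using eq row cE[OF c] parity[OF c c, of s t] unfolding v by auto
      qed
    qed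
    show ?thesis
    proof (rule cayley_transversalI)
      fix x y assume "(x, y) \<in> T c b"
      then show "x \<in> carrier G \<and> y \<in> carrier G"
        using cE[OF c] by (auto simp: T_def)
    next
      fix x y x' y' assume "(x, y) \<in> T c b" "(x', y') \<in> T c b"
        and eq: "x = x' \<or> y = y' \<or> x \<otimes> y = x' \<otimes> y'"
      then obtain s t where s: "b + 1 - d c \<le> s" "s < b + 2 * m - d c" "x = w s" "y = v b s \<otimes> c"
        and t: "b + 1 - d c \<le> t" "t < b + 2 * m - d c" "x' = w t" "y' = v b t \<otimes> c"
        by (auto simp: T_def)
      have "\<not> s < t"
        using less[of s t] eq s t by blast
      moreover have "\<not> t < s"
        using less[of t s] eq s t by metis
      ultimately have "s = t"
        by linarith
      then show "x = x' \<and> y = y'"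
        using s t by simp
    qed
  qed
  have U0: "cayley_transversal G U0"
  proof (rule cayley_transversalI)
    fix x y assume "(x, y) \<in> U0"
    then show "x \<in> carrier G \<and> y \<in> carrier G"
      using cE by (auto simp: U0_def cell_def)
  next
    fix x y x' y' assume "(x, y) \<in> U0" "(x', y') \<in> U0" and eq: "x = x' \<or> y = y' \<or> x \<otimes> y = x' \<otimes> y'"
    then obtain c c' where c: "c \<in> E" "x = w (a c - d c)" "y = w (a c) \<otimes> c"
      and c': "c' \<in> E" "x' = w (a c' - d c')" "y' = w (a c') \<otimes> c'"
      by (auto simp: U0_def cell_def)
    have "c = c'"
      using sel[OF c(1) c'(1)] eq unfolding c c' by blast
    then show "x = x' \<and> y = y'"
      using c c' by simp
  qed
  have U1: "cayley_transversal G U1"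
  proof (rule cayley_transversalI)
    fix x y assume "(x, y) \<in> U1"
    then show "x \<in> carrier G \<and> y \<in> carrier G"
      using cE by (auto simp: U1_def cell_def)
  next
    fix x y x' y' assume "(x, y) \<in> U1" "(x', y') \<in> U1" and eq: "x = x' \<or> y = y' \<or> x \<otimes> y = x' \<otimes> y'"
    then obtain c c' where c: "c \<in> E" "x = w (a c + m - d c)" "y = w (a c + m) \<otimes> c"
      and c': "c' \<in> E" "x' = w (a c' + m - d c')" "y' = w (a c' + m) \<otimes> c'"
      by (auto simp: U1_def cell_def)
    \<comment> \<open>\<open>U1\<close> is \<open>U0\<close> with rows and columns multiplied by
      \<open>z\<close>, and the symbols stay the same because \<open>z\<close> squares to
      one.\<close>
    have row: "w (b + m - e) = w (b - e) \<otimes> z" for b e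
      using shift[of "b - e"] by (simp add: algebra_simps)
    have col: "w (b + m) \<otimes> k = (w b \<otimes> k) \<otimes> z" if "k \<in> carrier G" for b k
      using that z(1) by (simp add: shift m_ac)
    have sym: "(p \<otimes> z) \<otimes> (q \<otimes> z) = p \<otimes> q" if "p \<in> carrier G" "q \<in> carrier G" for p q
    proof -
      have "(p \<otimes> z) \<otimes> (q \<otimes> z) = (p \<otimes> q) \<otimes> (z \<otimes> z)"
        using that z(1) by (simp only: m_ac m_closed)
      then show ?thesis
        using that z by simp
    qed
    have "c = c'"
      using sel[OF c(1) c'(1)] eq cE[OF c(1)] cE[OF c'(1)] z(1) unfolding c(2,3) c'(2,3) row
      by (simp add: col sym)
    then show "x = x' \<and> y = y'"
      using c c' by simp
  qed
  define \<S> where "\<S> = {U0, U1} \<union> (\<lambda>c. T c (a c)) ` E \<union> (\<lambda>c. T c (a c + m)) ` E"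
  have "finite \<S>"
    using E by (simp add: \<S>_def)
  moreover have "card \<S> \<le> 2 * card E + 2"
  proof -
    have "card \<S> \<le> card {U0, U1} + card ((\<lambda>c. T c (a c)) ` E) + card ((\<lambda>c. T c (a c + m)) ` E)"
      unfolding \<S>_def by (meson card_Un_le add_le_mono le_refl le_trans)
    also have "card {U0, U1} \<le> 2"
      by (simp add: card_insert_if)
    also have "card ((\<lambda>c. T c (a c)) ` E) \<le> card E"
      using E by (intro card_image_le)
    also have "card ((\<lambda>c. T c (a c + m)) ` E) \<le> card E"
      using E by (intro card_image_le)
    finally show ?thesis
      by simp
  qed
  moreover have "\<forall>S\<in>\<S>. cayley_transversal G S"
    using T U0 U1 by (auto simp: \<S>_def)
  moreover have "carrier G \<times> carrier G \<subseteq> \<Union>\<S>"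
  proof clarify
    fix x y assume "x \<in> carrier G" "y \<in> carrier G"
    then obtain t0 c where c: "c \<in> E" and x0: "x = w t0" and y0: "y = w t0 \<otimes> c \<or> y = w (t0 + 1) \<otimes> c"
      using cover by blast
    define t where "t = a c + (t0 - a c) mod (2 * m)"
    define k where "k = (t0 - a c) div (2 * m)"
    have k: "t0 = t + 2 * m * k" "t0 + 1 = (t + 1) + 2 * m * k"
      by (simp_all add: t_def k_def)
    have "w t0 = w t"
      unfolding k(1) by (rule period_mult)
    moreover have "w (t0 + 1) = w (t + 1)"
      unfolding k(2) by (rule period_mult)
    ultimately have x: "x = w t" and y: "y = w t \<otimes> c \<or> y = w (t + 1) \<otimes> c"
      using x0 y0 by simp_all
    have t: "a c \<le> t" "t < a c + 2 * m"
      using m by (simp_all add: t_def)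
    have inT: "(w s, v b s \<otimes> c) \<in> T c b" if "b + 1 - d c \<le> s" "s < b + 2 * m - d c" for s b
      using that by (auto simp: T_def)
    have S: "T c (a c) \<in> \<S>" "T c (a c + m) \<in> \<S>" "U0 \<in> \<S>" "U1 \<in> \<S>"
      using c by (auto simp: \<S>_def)
    have cells: "cell c (a c) \<in> U0" "cell c (a c + m) \<in> U1"
      using c by (auto simp: U0_def U1_def)
    have d01: "d c = 0 \<or> d c = 1"
      using d[OF c] by simp
    have "(x, y) \<in> T c (a c) \<or> (x, y) \<in> T c (a c + m) \<or> (x, y) = cell c (a c) \<or> (x, y) = cell c (a c + m)"
      using y
    proof
      assume y: "y = w t \<otimes> c"
      consider "t = a c" "d c = 0" | "t = a c + m" "d c = 0"
        | "a c + 1 - d c \<le> t" "t < a c + m" | "a c + m + 1 - d c \<le> t" "a c + m \<le> t"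
        using t d01 by linarith
      then show ?thesis
      proof cases
        case 3
        then show ?thesis
          using inT[of "a c" t] x y t d01 m by (auto simp: v_def)
      next
        case 4
        then show ?thesis
          using inT[of "a c + m" t] x y t d01 m by (auto simp: v_def)
      qed (use x y in \<open>simp_all add: cell_def\<close>)
    next
      assume y: "y = w (t + 1) \<otimes> c"
      consider "t = a c + m - 1" "d c = 1" | "t = a c + 2 * m - 1" "d c = 1"
        | "t < a c + m" "t < a c + m - d c" | "a c + m \<le> t" "t < a c + 2 * m - d c"
        using t d01 by linarith
      then show ?thesis
      proof cases
        case 1
        then show ?thesis
          using x y by (simp add: cell_def)
      next
        case 2
        then have "t = (a c - 1) + 2 * m" "t + 1 = a c + 2 * m"
          by simp_all
        then have "w t = w (a c - 1)" "w (t + 1) = w (a c)"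
          by (simp_all only: period)
        then show ?thesis
          using x y 2 by (simp add: cell_def)
      next
        case 3
        \<comment> \<open>The class \<open>T c (a c + m)\<close> meets this cell one period later,
          so the index is raised by \<open>2 * m\<close>.\<close>
        have "w (t + 2 * m + 1) = w (t + 1)"
          using period[of "t + 1"] by (simp add: algebra_simps)
        then have "v (a c + m) (t + 2 * m) = w (t + 1)" "w (t + 2 * m) = w t"
          using t period[of t] by (simp_all add: v_def)
        then show ?thesis
          using inT[of "a c + m" "t + 2 * m"] x y t 3 d01 m by auto
      next
        case 4
        then show ?thesis
          using inT[of "a c" t] x y t d01 m by (auto simp: v_def)
      qed
    qed
    then show "(x, y) \<in> \<Union>\<S>"
      using S cells by auto
  qed
  ultimately show ?thesis
    by blast
qed

text \<open>The data for \<open>ladder_coloring\<close> are assembled from two sides: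
  \<open>selection_exists\<close> governs the exponents of \<open>g\<close> in the cyclic quotient
  by \<open>H\<close>, and inside \<open>H\<close> the sequence \<open>r\<close> shapes the
  arrangement while the strong map \<open>f\<close> places the cuts.\<close>

lemma unique_involution_coloring:
  assumes fin: "finite (carrier G)" and z: "z \<in> carrier G" "z \<otimes> z = \<one>" "z \<noteq> \<one>"
    and uniq: "\<And>u. u \<in> carrier G \<Longrightarrow> u \<otimes> u = \<one> \<Longrightarrow> u = \<one> \<or> u = z"
  shows "\<exists>\<S>. finite \<S> \<and> card \<S> \<le> order G + 2 \<and> (\<forall>S\<in>\<S>. cayley_transversal G S) \<and>
    carrier G \<times> carrier G \<subseteq> \<Union>\<S>"
proof -
  obtain H f g where H: "subgroup H G" "odd (card H)" and f: "strong_map H f" and g: "g \<in> carrier G"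
    and gen: "\<And>x. x \<in> carrier G \<Longrightarrow> \<exists>i::int. \<exists>h\<in>H. x = h \<otimes> g [^] i"
    using strong_subgroup_cyclic_quotient[OF fin z(1,2) uniq] by blast
  interpret H: subgroup H G by fact
  note [simp] = g
  have fH [simp]: "f k \<in> H" if "k \<in> H" for k
    using f that by (auto simp: strong_map_def)
  obtain N where N: "N > 0" "\<And>i::int. g [^] i \<in> H \<longleftrightarrow> int N dvd i"
    by (rule subgroup_period[OF fin H(1) g]) blast
  have "adjoin H g = carrier G"
    using gen subgroup.subset[OF adjoin_subgroup[OF H(1) g]] by (fastforce simp: adjoin_def)
  then have order: "order G = N * card H"
    using adjoin_card[OF fin H(1) g N] by (simp add: order_def)
  have "ord z dvd 2" "ord z \<noteq> 1"
    using z pow_eq_id[OF z(1), of 2] ord_eq_1[OF z(1)] by (simp_all add: numeral_2_eq_2)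
  then have "ord z = 2"
    by (metis prime_nat_iff two_is_prime_nat)
  then have "even (order G)"
    using ord_dvd_group_order[OF z(1)] by simp
  then have "even N"
    using order H(2) by simp
  then obtain M' where M': "N = 2 * M'"
    by blast
  define M where "M = int M'"
  have M: "M \<ge> 1" "int N = 2 * M"
    using N(1) M' by (simp_all add: M_def)
  have pow: "g [^] i \<in> H \<longleftrightarrow> 2 * M dvd i" for i :: int
    using N(2) M(2) by simp
  have zH: "z \<notin> H"
    using odd_subgroup_square_cancel[OF H, of z \<one>] z by auto

  \<comment> \<open>The level of an element is its image in the cyclic quotient by \<open>H\<close>,
    an integer determined modulo \<open>2 * M\<close>.\<close>
  define lev where "lev x t \<longleftrightarrow> (\<exists>h\<in>H. x = h \<otimes> g [^] (t::int))" for x t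
  have lev_carrier: "x \<in> carrier G" if "lev x t" for x t
    using that by (auto simp: lev_def)
  have lev_unique: "2 * M dvd s - t" if "lev x s" "lev x t" for x s t
    using that mult_int_pow_eq_imp_mem[OF H(1) g] pow unfolding lev_def by blast
  have lev_mult: "lev (x \<otimes> y) (s + t)" if xs: "lev x s" and yt: "lev y t" for x y s t
  proof -
    obtain h where h: "h \<in> H" "x = h \<otimes> g [^] s"
      using xs by (auto simp: lev_def)
    obtain k where k: "k \<in> H" "y = k \<otimes> g [^] t"
      using yt by (auto simp: lev_def)
    have "x \<otimes> y = (h \<otimes> k) \<otimes> g [^] (s + t)"
      unfolding h(2) k(2) using h(1) k(1) by (simp add: int_pow_mult m_ac)
    then show ?thesis
      unfolding lev_def using H.m_closed[OF h(1) k(1)] by (intro bexI)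
  qed
  have lev_inv: "lev (inv x) (- t)" if xt: "lev x t" for x t
  proof -
    obtain h where *: "h \<in> H" "x = h \<otimes> g [^] t"
      using xt by (auto simp: lev_def)
    have "inv x = inv h \<otimes> g [^] (- t)"
      unfolding *(2) using *(1) by (simp add: int_pow_neg inv_mult)
    then show ?thesis
      unfolding lev_def using H.m_inv_closed[OF *(1)] by (intro bexI)
  qed
  have lev_H: "lev h 0" if "h \<in> H" for h
    unfolding lev_def using that by (intro bexI[of _ h]) simp_all
  have lev_g: "lev (g [^] t) t" for t
    unfolding lev_def using H.one_closed by (intro bexI[of _ \<one>]) simp_all

  \<comment> \<open>Outside \<open>H\<close>, the involution \<open>z\<close> has an image of order
    two in a cyclic group of order \<open>2 * M\<close>, and \<open>M\<close> is the only such
    level.\<close>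
  have lev_z: "lev z M"
  proof -
    obtain i h where h: "h \<in> H" "z = h \<otimes> g [^] (i::int)"
      using gen[OF z(1)] by blast
    have "lev z i"
      unfolding lev_def using h by blast
    then have "lev (z \<otimes> z) (i + i)"
      by (intro lev_mult)
    then have "2 * M dvd (i + i) - 0"
      using lev_H[OF H.one_closed] unfolding z(2) by (rule lev_unique)
    then have "2 * M dvd 2 * i"
      by simp
    then have "M dvd i"
      by (metis dvd_times_left_cancel_iff zero_neq_numeral)
    then obtain k where k: "i = M * k"
      by blast
    have "g [^] i \<notin> H"
      using h zH by auto
    then have "\<not> 2 * M dvd i"
      using pow by simp
    then have "odd k"
      using k by (auto elim!: evenE)
    then obtain l where "k = 2 * l + 1"
      by (auto elim: oddE)
    then have i: "i = 2 * M * l + M"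
      by (simp add: k algebra_simps)
    have "z = (h \<otimes> g [^] (2 * M * l)) \<otimes> g [^] M"
      using h unfolding i by (simp add: int_pow_mult m_assoc)
    moreover have "h \<otimes> g [^] (2 * M * l) \<in> H"
      using h pow by simp
    ultimately show ?thesis
      unfolding lev_def by blast
  qed
  then obtain hz where hz: "hz \<in> H" "z = hz \<otimes> g [^] M"
    unfolding lev_def by blast
  have lev_z_pow: "lev (z [^] j) (M * j)" for j :: int
  proof -
    have "z [^] j = hz [^] j \<otimes> g [^] (M * j)"
      using hz by (simp add: int_pow_distrib int_pow_pow)
    then show ?thesis
      unfolding lev_def using subgroup_int_pow_closed[OF H(1) hz(1)] by blast
  qed
  have z_even: "z [^] (2 * k) = \<one>" for k :: int
  proof -
    have "z [^] (2 * k) = (z \<otimes> z) [^] k"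
      using z(1) by (simp only: mult_2 int_pow_mult int_pow_distrib)
    then show ?thesis
      using z(2) by simp
  qed

  obtain r where r: "hamiltonian_sequence H r"
    using hamiltonian_sequence_exists[OF fin H] by blast
  define h where "h = int (card H)"
  have rH [simp]: "r t \<in> H" "r t \<in> carrier G" and r_per: "r (t + h) = r t" for t
    using r by (auto simp: hamiltonian_sequence_def h_def)
  have r_inj: "h dvd s - t" if "r s = r t" for s t
    using r that by (simp add: hamiltonian_sequence_def h_def)
  have r_sum: "h dvd s - t" if "r s \<otimes> r (s + 1) = r t \<otimes> r (t + 1)" for s t
    using r that by (simp add: hamiltonian_sequence_def h_def)
  have h: "odd h" "h \<ge> 1"
    using H(2) odd_pos[OF H(2)] by (simp_all add: h_def)
  define m where "m = M * h"
  have m1: "m \<ge> 1"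
    using M(1) h(2) by (simp add: m_def mult_pos_pos int_one_le_iff_zero_less)
  have orderm: "int (order G) = 2 * m"
    using order M(2) by (simp add: m_def h_def)

  \<comment> \<open>The sequence climbs along \<open>g\<close> through \<open>M\<close> levels, half of the quotient by \<open>H\<close>, and then jumps
    by the involution, moving on in \<open>H\<close> at the same time.\<close>
  define w where "w t = g [^] (t mod M) \<otimes> (z [^] (t div M) \<otimes> r (t div M))" for t
  have wG [simp]: "w t \<in> carrier G" for t
    using z by (simp add: w_def)
  have lev_w: "lev (w t) t" for t
  proof -
    have "lev (w t) (t mod M + (M * (t div M) + 0))"
      unfolding w_def by (intro lev_mult lev_g lev_z_pow lev_H rH)
    then show ?thesis
      by simp
  qed
  have digits: "s mod M = t mod M" "s - t = M * (s div M - t div M)" if "M dvd s - t" for s t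
  proof -
    show *: "s mod M = t mod M"
      using that by (simp add: mod_eq_dvd_iff)
    have "s - t = (M * (s div M) + s mod M) - (M * (t div M) + t mod M)"
      by simp
    then show "s - t = M * (s div M - t div M)"
      unfolding * by (simp only: right_diff_distrib)
  qed
  \<comment> \<open>Passing over \<open>h\<close> blocks brings \<open>r\<close> back and, as
    \<open>h\<close> is odd, contributes one factor \<open>z\<close>.\<close>
  have shift: "w (t + m) = w t \<otimes> z" for t
  proof -
    have "t + m = t + h * M"
      by (simp add: m_def)
    then have *: "(t + m) mod M = t mod M" "(t + m) div M = t div M + h"
      using M(1) by simp_all
    obtain l where l: "h = 2 * l + 1"
      using h(1) by (auto elim: oddE)
    have "z [^] (t div M + h) = z [^] (t div M) \<otimes> (z [^] (2 * l) \<otimes> z [^] (1::int))"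
      unfolding l using z(1) by (simp only: int_pow_mult)
    then have "z [^] (t div M + h) = z [^] (t div M) \<otimes> z"
      unfolding z_even using z(1) by simp
    then show ?thesis
      unfolding w_def * r_per using z(1) by (simp add: m_ac)
  qed
  \<comment> \<open>The level fixes the place inside a block and the block number modulo 2;
    \<open>r\<close> fixes the block number modulo \<open>h\<close>, which is coprime to 2.\<close>
  have inj: "2 * m dvd s - t" if eq: "w s = w t" for s t
  proof -
    have lev2: "2 * M dvd s - t"
      using lev_unique[OF lev_w[of s]] lev_w[of t] eq by simp
    then have "M dvd s - t"
      by (rule dvd_mult_right)
    note st = digits[OF this]
    have "2 * M dvd M * (s div M - t div M)"
      using lev2 st(2) by simp
    then have "M * 2 dvd M * (s div M - t div M)"
      by (simp add: mult.commute)
    then have even: "2 dvd s div M - t div M"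
      using M(1) by simp
    then obtain k where k: "s div M = t div M + 2 * k"
      by (metis diff_eq_eq dvdE add.commute)
    have "z [^] (s div M) = z [^] (t div M)"
      unfolding k using z(1) by (simp add: int_pow_mult z_even)
    then have "r (s div M) = r (t div M)"
      using eq st(1) z(1) by (simp add: w_def)
    then have "h dvd s div M - t div M"
      by (rule r_inj)
    with even have "2 * h dvd s div M - t div M"
      using h(1) by (simp add: divides_mult)
    then have "M * (2 * h) dvd s - t"
      unfolding st(2) by (rule mult_dvd_mono[OF dvd_refl])
    then show ?thesis
      by (simp add: m_def mult.left_commute)
  qed
  \<comment> \<open>Normal form of consecutive products: inside a block the powers of
    \<open>z\<close> cancel, while across a jump one factor \<open>z\<close> survives.\<close>
  define c where "c t = (if t mod M = M - 1 then z \<otimes> (r (t div M) \<otimes> r (t div M + 1))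
    else r (t div M) \<otimes> r (t div M))" for t
  define e where "e t = (if t mod M = M - 1 then M - 1 else 2 * (t mod M) + 1)" for t
  have cG [simp]: "c t \<in> carrier G" for t
    using z(1) by (simp add: c_def)
  have ww: "w t \<otimes> w (t + 1) = g [^] e t \<otimes> c t" for t
  proof (cases "t mod M = M - 1")
    case True
    then have *: "(t + 1) mod M = 0" "(t + 1) div M = t div M + 1"
      using int_add_carry[of M t] M(1) by simp_all
    have "z [^] (t div M) \<otimes> z [^] (t div M + 1) = z [^] (2 * (t div M) + 1)"
    proof -
      have "2 * (t div M) + 1 = t div M + (t div M + 1)"
        by simp
      then show ?thesis
        using z(1) by (simp only: int_pow_mult)
    qed
    also have "\<dots> = z"
      using z(1) by (simp add: int_pow_mult z_even)
    finally have zz: "z [^] (t div M) \<otimes> z [^] (t div M + 1) = z" .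
    have "w t \<otimes> w (t + 1) = g [^] (M - 1) \<otimes>
      ((z [^] (t div M) \<otimes> z [^] (t div M + 1)) \<otimes> (r (t div M) \<otimes> r (t div M + 1)))"
      unfolding w_def * True using z(1) by (simp add: m_ac)
    then show ?thesis
      unfolding zz using True by (simp add: c_def e_def)
  next
    case False
    moreover have "0 \<le> t mod M" "t mod M < M"
      using M(1) by simp_all
    ultimately have *: "0 \<le> t mod M + 1" "t mod M + 1 < M"
      by linarith+
    note t1 = int_add_no_carry[OF *]
    have zz: "z [^] (t div M) \<otimes> z [^] (t div M) = \<one>"
    proof -
      have "z [^] (2 * (t div M)) = z [^] (t div M) \<otimes> z [^] (t div M)"
        using z(1) by (simp only: mult_2 int_pow_mult)
      then show ?thesis
        by (simp only: z_even)
    qed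
    have gg: "g [^] (t mod M) \<otimes> g [^] (t mod M + 1) = g [^] (2 * (t mod M) + 1)"
    proof -
      have "2 * (t mod M) + 1 = t mod M + (t mod M + 1)"
        by simp
      then show ?thesis
        using g by (simp only: int_pow_mult)
    qed
    have "w t \<otimes> w (t + 1) = (g [^] (t mod M) \<otimes> g [^] (t mod M + 1)) \<otimes>
      ((z [^] (t div M) \<otimes> z [^] (t div M)) \<otimes> (r (t div M) \<otimes> r (t div M)))"
      unfolding w_def t1 using z(1) by (simp only: m_ac m_closed int_pow_closed g rH)
    then show ?thesis
      unfolding zz gg using False by (simp add: c_def e_def)
  qed
  have sum: "m dvd s - t" if eq: "w s \<otimes> w (s + 1) = w t \<otimes> w (t + 1)" for s t
  proof -
    have "2 * M dvd (s + (s + 1)) - (t + (t + 1))"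
      using lev_mult[OF lev_w[of s] lev_w[of "s + 1"]] lev_mult[OF lev_w[of t] lev_w[of "t + 1"]]
      unfolding eq by (rule lev_unique)
    moreover have "(s + (s + 1)) - (t + (t + 1)) = 2 * (s - t)"
      by simp
    ultimately have "M dvd s - t"
      by (metis dvd_times_left_cancel_iff zero_neq_numeral)
    note st = digits[OF this]
    have "e s = e t"
      using st(1) by (simp add: e_def)
    then have ceq: "c s = c t"
      using eq by (simp add: ww)
    have "h dvd s div M - t div M"
    proof (cases "t mod M = M - 1")
      case True
      then have "r (s div M) \<otimes> r (s div M + 1) = r (t div M) \<otimes> r (t div M + 1)"
        using ceq st(1) z(1) by (simp add: c_def)
      then show ?thesis
        by (rule r_sum)
    next
      case False
      then have "r (s div M) \<otimes> r (s div M) = r (t div M) \<otimes> r (t div M)"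
        using ceq st(1) by (simp add: c_def)
      then show ?thesis
        by (rule r_inj[OF odd_subgroup_square_cancel[OF H rH(1) rH(1)]])
    qed
    then show ?thesis
      unfolding m_def st(2) by (rule mult_dvd_mono[OF dvd_refl])
  qed

  \<comment> \<open>The elements of even level, half of the group; they index the ladders.\<close>
  define E where "E = adjoin H (g [^] (2::int))"
  have EG: "E \<subseteq> carrier G"
    unfolding E_def using subgroup.subset[OF adjoin_subgroup[OF H(1)]] by simp
  have cardE: "2 * card E = order G"
  proof -
    have "(g [^] (2::int)) [^] i \<in> H \<longleftrightarrow> int M' dvd i" for i :: int
    proof -
      have "(g [^] (2::int)) [^] i \<in> H \<longleftrightarrow> 2 * M dvd 2 * i"
        by (simp add: int_pow_pow pow)
      also have "\<dots> \<longleftrightarrow> M dvd i"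
        by (metis dvd_times_left_cancel_iff zero_neq_numeral)
      finally show ?thesis
        by (simp add: M_def)
    qed
    moreover have "M' > 0"
      using N(1) M' by simp
    ultimately have "card E = M' * card H"
      unfolding E_def by (intro adjoin_card[OF fin H(1)]) simp_all
    then show ?thesis
      using order M' by simp
  qed
  have E_lev: "x \<in> E \<longleftrightarrow> (\<exists>i. lev x (2 * i))" for x
    unfolding E_def adjoin_def lev_def by (auto simp: int_pow_pow)

  have surj: "\<exists>t. x = w t" if x: "x \<in> carrier G" for x
  proof -
    have "inj_on w {0..<2 * m}"
      by (intro inj_onI) (metis inj int_dvd_diff_imp_eq)
    then have "card (w ` {0..<2 * m}) = card (carrier G)"
      using orderm by (simp add: card_image order_def)
    then have "w ` {0..<2 * m} = carrier G"
      using fin by (intro card_subset_eq) auto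
    then show ?thesis
      using x by blast
  qed

  obtain A d where d01: "\<And>i. i \<in> {0..<M} \<Longrightarrow> d i \<in> {0, 1}"
    and dA: "\<And>i. i \<in> {0..<M} \<Longrightarrow> d i = 1 \<Longrightarrow> \<not> M dvd A i"
    and dist: "\<And>i j. i \<in> {0..<M} \<Longrightarrow> j \<in> {0..<M} \<Longrightarrow>
       2 * M dvd (A i - d i) - (A j - d j) \<or> 2 * M dvd (A i + 2 * i) - (A j + 2 * j) \<or>
       2 * M dvd (2 * A i + 2 * i - d i) - (2 * A j + 2 * j - d j) \<Longrightarrow> i = j"
    using selection_exists[OF M(1)] by metis
  \<comment> \<open>The ladder of \<open>k \<otimes> g [^] (2 * i)\<close> is to be cut where
    \<open>w\<close> has exponent \<open>A i\<close> and component \<open>f k\<close>; such a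
    position exists because \<open>w\<close> is surjective.\<close>
  have "\<exists>i k b. i \<in> {0..<M} \<and> k \<in> H \<and> x = k \<otimes> g [^] (2 * i) \<and> w b = g [^] A i \<otimes> f k" if "x \<in> E" for x
  proof -
    obtain j k where jk: "k \<in> H" "x = k \<otimes> g [^] (2 * j :: int)"
      using \<open>x \<in> E\<close> unfolding E_lev lev_def by blast
    have "2 * j = 2 * M * (j div M) + 2 * (j mod M)"
      by (simp add: mult.assoc flip: distrib_left)
    then have "x = (k \<otimes> g [^] (2 * M * (j div M))) \<otimes> g [^] (2 * (j mod M))"
      using jk by (simp add: int_pow_mult m_assoc)
    moreover have k': "k \<otimes> g [^] (2 * M * (j div M)) \<in> H"
      using jk pow by simp
    moreover have "j mod M \<in> {0..<M}"
      using M(1) by simp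
    moreover obtain b where "w b = g [^] A (j mod M) \<otimes> f (k \<otimes> g [^] (2 * M * (j div M)))"
      using surj[of "g [^] A (j mod M) \<otimes> f (k \<otimes> g [^] (2 * M * (j div M)))"] fH[OF k'] by force
    ultimately show ?thesis
      by blast
  qed
  then obtain i k a where ika: "\<And>x. x \<in> E \<Longrightarrow> i x \<in> {0..<M}" "\<And>x. x \<in> E \<Longrightarrow> k x \<in> H"
    "\<And>x. x \<in> E \<Longrightarrow> x = k x \<otimes> g [^] (2 * i x)" "\<And>x. x \<in> E \<Longrightarrow> w (a x) = g [^] A (i x) \<otimes> f (k x)"
    by metis
  have kG: "k x \<in> carrier G" "f (k x) \<in> carrier G" if "x \<in> E" for x
    using ika(2)[OF that] by auto
  have row: "w (a x - d (i x)) = g [^] (A (i x) - d (i x)) \<otimes> f (k x)" if x: "x \<in> E" for x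
  proof (cases "d (i x) = 0")
    case True
    then show ?thesis
      using ika(4)[OF x] by simp
  next
    case False
    then have d1: "d (i x) = 1"
      using d01[OF ika(1)[OF x]] by simp
    \<comment> \<open>As \<open>A (i x)\<close> is no multiple of \<open>M\<close>, position
      \<open>a x\<close> is not the start of a block, so one step back divides by \<open>g\<close>
      without a jump.\<close>
    have "lev (w (a x)) (A (i x) + 0)"
      unfolding ika(4)[OF x] using ika(2)[OF x] by (intro lev_mult lev_g lev_H fH)
    then have "2 * M dvd a x - A (i x)"
      using lev_unique[OF lev_w[of "a x"]] by simp
    then have "M dvd a x - A (i x)"
      by (rule dvd_mult_right)
    moreover have "\<not> M dvd A (i x)"
      by (rule dA[OF ika(1)[OF x] d1])
    ultimately have "\<not> M dvd a x"
      by (metis dvd_diff_commute dvd_diff_right_iff dvd_diff_left_iff)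
    then have "a x mod M \<noteq> 0"
      by (simp add: dvd_eq_mod_eq_0)
    moreover have "0 \<le> a x mod M" "a x mod M < M"
      using M(1) by simp_all
    ultimately have *: "0 \<le> a x mod M - 1" "a x mod M - 1 < M"
      by linarith+
    have t1: "(a x - 1) mod M = a x mod M - 1" "(a x - 1) div M = a x div M"
      using int_add_no_carry[of "a x" M "- 1"] * by simp_all
    have "w (a x - 1) = g [^] (a x mod M - 1) \<otimes> (z [^] (a x div M) \<otimes> r (a x div M))"
      unfolding w_def t1 ..
    also have "\<dots> = inv g \<otimes> w (a x)"
      unfolding w_def using z(1) by (simp add: int_pow_diff m_ac)
    also have "\<dots> = g [^] (A (i x) - 1) \<otimes> f (k x)"
      unfolding ika(4)[OF x] using kG[OF x] by (simp add: int_pow_diff m_ac)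
    finally show ?thesis
      by (simp add: d1)
  qed
  have col: "w (a x) \<otimes> x = g [^] (A (i x) + 2 * i x) \<otimes> (f (k x) \<otimes> k x)" if x: "x \<in> E" for x
  proof -
    have "w (a x) \<otimes> x = (g [^] A (i x) \<otimes> f (k x)) \<otimes> (k x \<otimes> g [^] (2 * i x))"
      using ika(3,4)[OF x] by simp
    then show ?thesis
      using kG[OF x] by (simp add: int_pow_mult m_ac)
  qed
  have sym: "w (a x - d (i x)) \<otimes> (w (a x) \<otimes> x) =
    g [^] (2 * A (i x) + 2 * i x - d (i x)) \<otimes> (f (k x) \<otimes> (f (k x) \<otimes> k x))" if x: "x \<in> E" for x
  proof -
    have *: "2 * A (i x) + 2 * i x - d (i x) = (A (i x) - d (i x)) + (A (i x) + 2 * i x)"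
      by simp
    have "g [^] (2 * A (i x) + 2 * i x - d (i x)) = g [^] (A (i x) - d (i x)) \<otimes> g [^] (A (i x) + 2 * i x)"
      unfolding * by (rule int_pow_mult[OF g])
    then show ?thesis
      unfolding row[OF x] col[OF x] using kG[OF x] by (simp add: m_ac)
  qed
  have split: "2 * M dvd s - t" "s = t \<Longrightarrow> x = y"
    if "x \<in> H" "y \<in> H" "g [^] s \<otimes> x = g [^] t \<otimes> y" for x y s t
  proof -
    have "lev (g [^] s \<otimes> x) (s + 0)" "lev (g [^] t \<otimes> y) (t + 0)"
      using that by (intro lev_mult lev_g lev_H; simp)+
    then show "2 * M dvd s - t"
      using lev_unique that(3) by simp
    show "x = y" if "s = t"
      using \<open>g [^] s \<otimes> x = g [^] t \<otimes> y\<close> \<open>x \<in> H\<close> \<open>y \<in> H\<close> that by simp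
  qed
  have sel: "x = y" if xy: "x \<in> E" "y \<in> E"
    and eq: "w (a x - d (i x)) = w (a y - d (i y)) \<or> w (a x) \<otimes> x = w (a y) \<otimes> y \<or>
      w (a x - d (i x)) \<otimes> (w (a x) \<otimes> x) = w (a y - d (i y)) \<otimes> (w (a y) \<otimes> y)" for x y
  proof -
    note kH = ika(2)[OF xy(1)] ika(2)[OF xy(2)]
    have cl: "f (k x) \<in> H" "f (k y) \<in> H" "f (k x) \<otimes> k x \<in> H" "f (k y) \<otimes> k y \<in> H"
      "f (k x) \<otimes> (f (k x) \<otimes> k x) \<in> H" "f (k y) \<otimes> (f (k y) \<otimes> k y) \<in> H"
      using kH by simp_all
    have eq': "g [^] (A (i x) - d (i x)) \<otimes> f (k x) = g [^] (A (i y) - d (i y)) \<otimes> f (k y) \<or>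
      g [^] (A (i x) + 2 * i x) \<otimes> (f (k x) \<otimes> k x) = g [^] (A (i y) + 2 * i y) \<otimes> (f (k y) \<otimes> k y) \<or>
      g [^] (2 * A (i x) + 2 * i x - d (i x)) \<otimes> (f (k x) \<otimes> (f (k x) \<otimes> k x)) =
      g [^] (2 * A (i y) + 2 * i y - d (i y)) \<otimes> (f (k y) \<otimes> (f (k y) \<otimes> k y))"
      using eq row[OF xy(1)] row[OF xy(2)] col[OF xy(1)] col[OF xy(2)] sym[OF xy(1)] sym[OF xy(2)]
      by metis
    \<comment> \<open>Levels are compared first, where \<open>selection_exists\<close> applies;
      after cancelling the powers of \<open>g\<close>, the strong map separates the components in
      \<open>H\<close>.\<close>
    then have "i x = i y"
      using split(1)[OF cl(1,2)] split(1)[OF cl(3,4)] split(1)[OF cl(5,6)]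
      by (intro dist ika(1) xy) blast
    with eq' have "f (k x) = f (k y) \<or> f (k x) \<otimes> k x = f (k y) \<otimes> k y \<or>
      f (k x) \<otimes> (f (k x) \<otimes> k x) = f (k y) \<otimes> (f (k y) \<otimes> k y)"
      using split(2)[OF cl(1,2)] split(2)[OF cl(3,4)] split(2)[OF cl(5,6)] by metis
    then have "k x = k y"
      using f kH unfolding strong_map_def inj_on_def by blast
    then show "x = y"
      using ika(3)[OF xy(1)] ika(3)[OF xy(2)] \<open>i x = i y\<close> by metis
  qed

  have "\<exists>\<S>. finite \<S> \<and> card \<S> \<le> 2 * card E + 2 \<and> (\<forall>S\<in>\<S>. cayley_transversal G S) \<and>
    carrier G \<times> carrier G \<subseteq> \<Union>\<S>"
  proof (rule ladder_coloring[where m = m and w = w and z = z and a = a and d = "\<lambda>x. d (i x)"])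
    show "finite E"
      using finite_subset[OF EG fin] .
    fix s t x y assume "x \<in> E" "y \<in> E"
    then obtain p q where pq: "lev x (2 * p)" "lev y (2 * q)"
      unfolding E_lev by blast
    \<comment> \<open>Symbols of the first kind have even level and those of the second kind odd
      level; parity makes sense because levels are taken modulo \<open>2 * M\<close>.\<close>
    have 1: "lev (w s \<otimes> (w s \<otimes> x)) (s + (s + 2 * p))"
      and 2: "lev (w t \<otimes> (w (t + 1) \<otimes> y)) (t + ((t + 1) + 2 * q))"
      by (rule lev_mult[OF lev_w lev_mult[OF lev_w pq(1)]], rule lev_mult[OF lev_w lev_mult[OF lev_w pq(2)]])
    show "w s \<otimes> (w s \<otimes> x) \<noteq> w t \<otimes> (w (t + 1) \<otimes> y)"
    proof
      assume "w s \<otimes> (w s \<otimes> x) = w t \<otimes> (w (t + 1) \<otimes> y)"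
      then have "2 * M dvd (s + (s + 2 * p)) - (t + ((t + 1) + 2 * q))"
        using 1 2 lev_unique by simp
      then have "2 dvd (s + (s + 2 * p)) - (t + ((t + 1) + 2 * q))"
        by (rule dvd_mult_left)
      then show False
        by presburger
    qed
  next
    fix x y assume x: "x \<in> carrier G" and y: "y \<in> carrier G"
    obtain t where t: "x = w t"
      using surj[OF x] by blast
    \<comment> \<open>The parity of this level decides which kind of cell \<open>(x, y)\<close> is,
      since neighbouring elements of \<open>w\<close> differ by one level.\<close>
    obtain u where u: "lev (y \<otimes> inv x) u"
      using gen[of "y \<otimes> inv x"] x y unfolding lev_def by auto
    have yx: "y = v \<otimes> (y \<otimes> inv v)" if "v \<in> carrier G" for v
      using y that by (simp add: m_lcomm[of v y])
    show "\<exists>t. \<exists>c\<in>E. x = w t \<and> (y = w t \<otimes> c \<or> y = w (t + 1) \<otimes> c)"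
    proof (cases "even u")
      case True
      then have "y \<otimes> inv x \<in> E"
        using u unfolding E_lev by (auto elim: evenE)
      then show ?thesis
        using t yx[OF x] by blast
    next
      case False
      have "lev ((y \<otimes> inv x) \<otimes> (x \<otimes> inv (w (t + 1)))) (u + (t + - (t + 1)))"
        using u lev_w[of t] t by (intro lev_mult lev_inv lev_w) simp_all
      moreover have "(y \<otimes> inv x) \<otimes> (x \<otimes> inv (w (t + 1))) = y \<otimes> inv (w (t + 1))"
        using x y by (simp add: m_assoc[symmetric]) (simp add: m_assoc)
      moreover obtain l where "u + (t + - (t + 1)) = 2 * l"
        using False by (auto elim: oddE)
      ultimately have "y \<otimes> inv (w (t + 1)) \<in> E"
        unfolding E_lev by metis
      then show ?thesis
        using t yx[OF wG[of "t + 1"]] by blast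
    qed
  next
    show "d (i x) \<in> {0, 1}" if "x \<in> E" for x
      by (rule d01[OF ika(1)[OF that]])
  next
    show "x = y" if "x \<in> E" "y \<in> E"
      "w (a x - d (i x)) = w (a y - d (i y)) \<or> w (a x) \<otimes> x = w (a y) \<otimes> y \<or>
      w (a x - d (i x)) \<otimes> (w (a x) \<otimes> x) = w (a y - d (i y)) \<otimes> (w (a y) \<otimes> y)" for x y
      by (rule sel[OF that])
  qed (fact m1 wG EG z(1,2) uniq shift inj sum)+
  then show ?thesis
    unfolding cardE .
qed

end

section \<open>The chromatic number\<close>

context comm_group
begin

lemma finprod_bij_betw_carrier:
  assumes "bij_betw h A (carrier G)"
  shows "finprod G h A = finprod G (\<lambda>x. x) (carrier G)"
  using assms finprod_reindex[of "\<lambda>x. x" h A] by (auto simp: bij_betw_def)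

text \<open>Hall's theorem is applied with the enumeration \<open>e\<close> itself as quotients: the
  cells \<open>(e i, x i)\<close> carry the symbols \<open>y i\<close>, so rows, columns and symbols
  all run through the group. Multiplying the columns by each \<open>c\<close> gives all
  classes.\<close>

lemma orthogonal_mate_coloring:
  fixes n :: nat
  assumes prod: "finprod G (\<lambda>x. x) (carrier G) = \<one>" and e: "bij_betw e {..<n} (carrier G)"
  shows "\<exists>\<S>. finite \<S> \<and> card \<S> \<le> n \<and> (\<forall>S\<in>\<S>. cayley_transversal G S) \<and>
    carrier G \<times> carrier G \<subseteq> \<Union>\<S>"
proof -
  have eG: "e i \<in> carrier G" if "i < n" for i
    using bij_betwE[OF e] that by simp
  have "finprod G e {..<n} = \<one>"
    unfolding finprod_bij_betw_carrier[OF e] by (rule prod)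
  then have "\<exists>x y. bij_betw x {..<n} (carrier G) \<and> bij_betw y {..<n} (carrier G) \<and>
    (\<forall>i<n. y i = x i \<otimes> e i)"
    using eG by (intro hall_difference_representation[OF e])
  then obtain x y where x: "bij_betw x {..<n} (carrier G)" and y: "bij_betw y {..<n} (carrier G)"
    and xy: "\<And>i. i < n \<Longrightarrow> y i = x i \<otimes> e i"
    by blast
  have xG: "x i \<in> carrier G" and yG: "y i \<in> carrier G" if "i < n" for i
    using bij_betwE[OF x] bij_betwE[OF y] that by simp_all
  have inj: "i = j" if "i < n" "j < n" "e i = e j \<or> x i = x j \<or> y i = y j" for i j
    using that e x y by (auto simp: bij_betw_def inj_on_def)
  define T where "T c = (\<lambda>i. (e i, x i \<otimes> c)) ` {..<n}" for c
  have "cayley_transversal G (T c)" if c: "c \<in> carrier G" for c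
  proof (rule cayley_transversalI)
    fix u v assume "(u, v) \<in> T c"
    then show "u \<in> carrier G \<and> v \<in> carrier G"
      using c eG xG by (auto simp: T_def)
  next
    fix u v u' v' assume "(u, v) \<in> T c" "(u', v') \<in> T c" and eq: "u = u' \<or> v = v' \<or> u \<otimes> v = u' \<otimes> v'"
    then obtain i j where i: "i < n" "u = e i" "v = x i \<otimes> c" and j: "j < n" "u' = e j" "v' = x j \<otimes> c"
      by (auto simp: T_def)
    have "e k \<otimes> (x k \<otimes> c) = y k \<otimes> c" if "k < n" for k
      using c eG[OF that] xG[OF that] by (simp add: xy[OF that] m_ac)
    then have "e i = e j \<or> x i \<otimes> c = x j \<otimes> c \<or> y i \<otimes> c = y j \<otimes> c"
      using eq i j by metis
    then have "i = j"
      using inj[OF i(1) j(1)] c xG[OF i(1)] xG[OF j(1)] yG[OF i(1)] yG[OF j(1)] by simp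
    then show "u = u' \<and> v = v'"
      using i j by simp
  qed
  moreover have "carrier G \<times> carrier G \<subseteq> \<Union>(T ` carrier G)"
  proof clarify
    fix u v assume u: "u \<in> carrier G" and v: "v \<in> carrier G"
    then obtain i where i: "i < n" "u = e i"
      using e by (auto simp: bij_betw_def)
    have "v = x i \<otimes> (inv (x i) \<otimes> v)"
      using xG[OF i(1)] v by (simp add: mult_inv_cancel_left)
    then have "(u, v) \<in> T (inv (x i) \<otimes> v)"
      unfolding T_def using i by auto
    moreover have "inv (x i) \<otimes> v \<in> carrier G"
      using xG[OF i(1)] v by simp
    ultimately show "(u, v) \<in> \<Union>(T ` carrier G)"
      by blast
  qed
  moreover have fin: "finite (carrier G)" and "card (carrier G) = n"
    using bij_betw_finite[OF e] bij_betw_same_card[OF e] by simp_all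
  moreover from this have "card (T ` carrier G) \<le> n"
    using card_image_le[OF fin, of T] by simp
  ultimately show ?thesis
    by (intro exI[of _ "T ` carrier G"]) auto
qed

text \<open>With \<open>n\<close> cells, rows, columns and symbols would each exhaust the group.
  Multiplying all symbols then shows that the product \<open>?P\<close> of all elements equals its
  own square, hence is one.\<close>

lemma card_partial_transversal_less:
  assumes P: "finprod G (\<lambda>x. x) (carrier G) \<noteq> \<one>" and g: "bij_betw g {..<n} (carrier G)"
    and T: "partial_transversal n (cayley_table G g) T"
  shows "card T < n"
proof (rule ccontr)
  let ?P = "finprod G (\<lambda>x. x) (carrier G)"
  assume "\<not> card T < n"
  then have card: "card T = n"
    using card_partial_transversal_le[OF T] by simp
  have sub: "T \<subseteq> {..<n} \<times> {..<n}" and inj: "inj_on fst T" "inj_on snd T"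
    "inj_on (\<lambda>(i, j). cayley_table G g i j) T"
    using T by (auto simp: partial_transversal_def cells_def)
  have gG: "g i \<in> carrier G" if "i < n" for i
    using bij_betwE[OF g] that by simp
  have fin: "finite (carrier G)" and cardG: "card (carrier G) = n"
    using bij_betw_finite[OF g] bij_betw_same_card[OF g] by simp_all
  have "fst ` T = {..<n}" "snd ` T = {..<n}"
    using sub inj card by (intro card_subset_eq; force simp: card_image)+
  then have "bij_betw fst T {..<n}" "bij_betw snd T {..<n}"
    using inj by (simp_all add: bij_betw_def)
  then have "bij_betw (g \<circ> fst) T (carrier G)" "bij_betw (g \<circ> snd) T (carrier G)"
    using g by (auto intro: bij_betw_trans)
  then have fs: "finprod G (g \<circ> fst) T = ?P" "finprod G (g \<circ> snd) T = ?P"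
    by (simp_all only: finprod_bij_betw_carrier)
  have "(\<lambda>(i, j). cayley_table G g i j) ` T = carrier G"
  proof (rule card_subset_eq[OF fin])
    show "(\<lambda>(i, j). cayley_table G g i j) ` T \<subseteq> carrier G"
      using sub gG by (auto simp: cayley_table_def)
    show "card ((\<lambda>(i, j). cayley_table G g i j) ` T) = card (carrier G)"
      using card_image[OF inj(3)] card cardG by simp
  qed
  then have "bij_betw (\<lambda>(i, j). cayley_table G g i j) T (carrier G)"
    using inj(3) by (simp add: bij_betw_def)
  then have "?P = finprod G (\<lambda>(i, j). cayley_table G g i j) T"
    by (simp only: finprod_bij_betw_carrier)
  also have "\<dots> = finprod G (\<lambda>p. (g \<circ> fst) p \<otimes> (g \<circ> snd) p) T"
    using sub gG by (intro finprod_cong') (auto simp: cayley_table_def)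
  also have "\<dots> = finprod G (g \<circ> fst) T \<otimes> finprod G (g \<circ> snd) T"
    using sub gG by (intro finprod_multf) auto
  finally have "?P = ?P \<otimes> ?P"
    unfolding fs .
  moreover have "?P \<in> carrier G"
    by (rule finprod_closed) simp
  ultimately show False
    using P by (metis r_cancel_one')
qed

end

theorem theorem1p6:
  fixes G :: "('a, 'b) monoid_scheme" and n :: nat and g :: "nat \<Rightarrow> 'a"
  assumes "comm_group G" and "finite (carrier G)" and "order G = n"
    and "bij_betw g {..<n} (carrier G)"
  shows "latin_chromatic_number n (cayley_table G g) =
    (if \<forall>P. sylow_subgroup 2 G P \<longrightarrow>
          trivial_group (G\<lparr>carrier := P\<rparr>) \<or> \<not> cyclic_group (G\<lparr>carrier := P\<rparr>)
     then n else n + 2)"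
proof -
  interpret comm_group G by fact
  let ?\<chi> = "latin_chromatic_number n (cayley_table G g)"
  have n: "n > 0"
    using assms(2,3) order_gt_0_iff_finite by blast
  show ?thesis
  proof (cases "\<exists>!z. z \<in> carrier G \<and> z \<otimes>\<^bsub>G\<^esub> z = \<one>\<^bsub>G\<^esub> \<and> z \<noteq> \<one>\<^bsub>G\<^esub>")
    case False
    have "\<exists>\<S>. finite \<S> \<and> card \<S> \<le> n \<and> (\<forall>S\<in>\<S>. cayley_transversal G S) \<and> carrier G \<times> carrier G \<subseteq> \<Union>\<S>"
      using finprod_carrier_eq_one[OF assms(2) False] assms(4) by (rule orthogonal_mate_coloring)
    then have "?\<chi> \<le> n"
      using cayley_chromatic_le[OF assms(4)] by (meson le_trans)
    moreover have "n * n \<le> ?\<chi> * n"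
      by (rule latin_chromatic_number_ge) (rule card_partial_transversal_le)
    ultimately have "?\<chi> = n"
      using n by simp
    then show ?thesis
      using False unique_involution_iff_sylow[OF assms(2)] by auto
  next
    case True
    then obtain z where z: "z \<in> carrier G" "z \<otimes>\<^bsub>G\<^esub> z = \<one>\<^bsub>G\<^esub>" "z \<noteq> \<one>\<^bsub>G\<^esub>"
      and uniq: "\<And>u. u \<in> carrier G \<Longrightarrow> u \<otimes>\<^bsub>G\<^esub> u = \<one>\<^bsub>G\<^esub> \<Longrightarrow> u = \<one>\<^bsub>G\<^esub> \<or> u = z"
      by blast
    have "\<exists>\<S>. finite \<S> \<and> card \<S> \<le> n + 2 \<and> (\<forall>S\<in>\<S>. cayley_transversal G S) \<and>
      carrier G \<times> carrier G \<subseteq> \<Union>\<S>"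
      using unique_involution_coloring[OF assms(2) z uniq] assms(3) by simp
    then have "?\<chi> \<le> n + 2"
      using cayley_chromatic_le[OF assms(4)] by (meson le_trans)
    moreover have "\<not> ?\<chi> \<le> n + 1"
    proof
      assume le: "?\<chi> \<le> n + 1"
      have "finprod G (\<lambda>x. x) (carrier G) \<noteq> \<one>\<^bsub>G\<^esub>"
        using finprod_carrier_unique_involution[OF assms(2) z uniq] z(3) by simp
      then have "card T \<le> n - 1" if "partial_transversal n (cayley_table G g) T" for T
        using card_partial_transversal_less[OF _ assms(4) that] by simp
      then have "n * n \<le> ?\<chi> * (n - 1)"
        by (rule latin_chromatic_number_ge)
      also have "\<dots> \<le> (n + 1) * (n - 1)"
        using le by (rule mult_le_mono1)
      also have "\<dots> < n * n"
        using n by (cases n) simp_all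
      finally show False
        by simp
    qed
    ultimately have "?\<chi> = n + 2"
      by simp
    then show ?thesis
      using True unique_involution_iff_sylow[OF assms(2)] by auto
  qed
qed

end
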